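(* Let $1<p<\infty$ and $L>0$, let $a\in\mathcal{A}_p$ be $L$-periodic and let $\rho$ be an $L$-periodic indefinite weight whose restriction to $(0,L)$ belongs to $L^1(0,L)$. Let $\bar\rho$ be the average of $\rho$ in the interval $(0,L)$, that is, $$\bar\rho=\frac1L\int_0^L\rho(t)\,dt,$$ and set $$a^*=\left(\int_0^L a(t)^{-\frac1{p-1}}\,dt\right)^{1-p}.$$ For a small parameter $\varepsilon>0$ let $\{\lambda_{\varepsilon,k}^{\pm}\}_{k\ge1}$ be the eigenvalues of $$\begin{cases}-\left(a(\tfrac{x}{\varepsilon})|u_\varepsilon'|^{p-2}u_\varepsilon'\right)'=\lambda_\varepsilon\,\rho(\tfrac{x}{\varepsilon})|u_\varepsilon|^{p-2}u_\varepsilon, & x\in(0,L),\\ u_\varepsilon(0)=u_\varepsilon(L)=0,\end{cases}$$ and let $\{\lambda_{0,k}\}_{k\ge1}$ be the eigenvalues of the limit problem $$\begin{cases}-(a^*|u'|^{p-2}u')'=\lambda_0\,\bar\rho\,|u|^{p-2}u, & x\in(0,L),\\ u(0)=u(L)=0.\end{cases}$$ Then, for each fixed $k\ge1$: 1. If $\bar\rho=0$, then $\lambda_{\varepsilon,k}^{\pm}\to\pm\infty$ as $\varepsilon\to0^+$. 2. If $\bar\rho<0$, then $\lambda_{\varepsilon,k}^-\to\lambda_{0,k}$ and $\lambda_{\varepsilon,k}^+\to+\infty$ as $\varepsilon\to0^+$. 3. If $\bar\rho>0$, then $\lambda_{\varepsilon,k}^+\to\lambda_{0,k}$ and $\lambda_{\varepsilon,k}^-\to-\infty$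 as $\varepsilon\to0^+$.
   Context: Indefinite weight means that $\rho$ changes sign: both $\rho^+=\max\{\rho,0\}$ and $\rho^-=(-\rho)^+$ are nonzero on sets of positive measure. The Muckenhoupt class $\mathcal{A}_p$ (in dimension one) is the set of nonnegative functions $a\in L^1_{loc}(\mathbb{R})$ for which there is a constant $c_{p,a}>0$ such that $$\left(\int_B a(x)\,dx\right)\left(\int_B a(x)^{-\frac1{p-1}}\,dx\right)^{p-1}\le c_{p,a}|B|^p$$ for every bounded interval $B\subset\mathbb{R}$. An eigenvalue is a real $\lambda$ for which the problem has a nontrivial solution (an eigenfunction). For each fixed $\varepsilon>0$, the $\varepsilon$-problem has two sequences of eigenvalues: the positive ones, in increasing order, $0<\lambda_{\varepsilon,1}^+<\lambda_{\varepsilon,2}^+<\cdots\to+\infty$, and the negative ones, in decreasing order, $0>\lambda_{\varepsilon,1}^->\lambda_{\varepsilon,2}^->\cdots\to-\infty$. Each $\lambda_{\varepsilon,k}^{\pm}$ is simple, with an eigenfunction (unique up to a multiplicative constant) having exactly $k+1$ zeros in $[0,L]$. When $\bar\rho\neq0$, the eigenvalues $\lambda_{0,k}$ of the limit problem all have the sign of $\bar\rho$ and are numbered in order of increasing absolute value (so the eigenfunction of $\lambda_{0,k}$ has exactly $k+1$ zeros in $[0,L]$); they are not involved in the case $\bar\rho=0$.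
   Formalization: The coefficient a* is taken as ((1/L)∫_0^L a^{-1/(p-1)} dt)^{1-p}, with the factor 1/L added; as displayed, the convergence in parts 2 and 3 fails for every L≠1 (e.g. a=1, where a* would be L^{1-p} instead of 1), and for L=1 the two formulas agree. *)

theory Defs
  imports "HOL-Analysis.Analysis"
begin

(* One-dimensional Muckenhoupt class. A weight is positive almost everywhere; this has to be said,
   since 0 powr q = 0 here, whereas the negative power a^(-1/(p-1)) is infinite where a vanishes.
   Integrability of that power on bounded intervals is finiteness of the second integral. *)
definition muckenhoupt :: "real \<Rightarrow> (real \<Rightarrow> real) \<Rightarrow> bool" where
  "muckenhoupt p a \<longleftrightarrow>
     (\<forall>x. 0 \<le> a x) \<and> (AE x in lebesgue. 0 < a x) \<and>
     (\<forall>l r. a absolutely_integrable_on {l..r}) \<and>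
     (\<forall>l r. (\<lambda>x. a x powr (- 1 / (p - 1))) absolutely_integrable_on {l..r}) \<and>
     (\<exists>c>0. \<forall>l r. l < r \<longrightarrow>
        integral {l..r} a * (integral {l..r} (\<lambda>x. a x powr (- 1 / (p - 1)))) powr (p - 1)
          \<le> c * (r - l) powr p)"

definition periodic :: "real \<Rightarrow> (real \<Rightarrow> real) \<Rightarrow> bool" where
  "periodic L f \<longleftrightarrow> (\<forall>x. f (x + L) = f x)"

definition indefinite_weight :: "(real \<Rightarrow> real) \<Rightarrow> bool" where
  "indefinite_weight \<rho> \<longleftrightarrow>
     emeasure lebesgue {x. max (\<rho> x) 0 \<noteq> 0} > 0 \<and>
     emeasure lebesgue {x. max (- \<rho> x) 0 \<noteq> 0} > 0"

(* f is absolutely continuous on [0,L] with almost-everywhere derivative f', expressed as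
   "f is an indefinite Lebesgue integral of f'". *)
definition abs_cont_deriv :: "real \<Rightarrow> (real \<Rightarrow> real) \<Rightarrow> (real \<Rightarrow> real) \<Rightarrow> bool" where
  "abs_cont_deriv L f f' \<longleftrightarrow>
     f' absolutely_integrable_on {0..L} \<and> (\<forall>x\<in>{0..L}. f x = f 0 + integral {0..x} f')"

(* At s = 0 the value is 0 for every p, as 0 powr q = 0. *)
definition phi :: "real \<Rightarrow> real \<Rightarrow> real" where
  "phi p s = \<bar>s\<bar> powr (p - 2) * s"

(* - (A |u'|^(p-2) u')' = lam R |u|^(p-2) u on (0,L), u(0) = u(L) = 0, in the Caratheodory sense:
   u and the flux w = A |u'|^(p-2) u' are absolutely continuous and the equation holds almost
   everywhere. The flux is only determined almost everywhere, so w is its continuous version. *)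
definition dirichlet_solution ::
  "real \<Rightarrow> real \<Rightarrow> (real \<Rightarrow> real) \<Rightarrow> (real \<Rightarrow> real) \<Rightarrow> real \<Rightarrow> (real \<Rightarrow> real) \<Rightarrow> bool" where
  "dirichlet_solution p L A R lam u \<longleftrightarrow>
     (\<exists>u' w w'. abs_cont_deriv L u u' \<and> abs_cont_deriv L w w' \<and>
        (AE x in lebesgue. x \<in> {0<..<L} \<longrightarrow>
           w x = A x * phi p (u' x) \<and> - w' x = lam * R x * phi p (u x))) \<and>
     u 0 = 0 \<and> u L = 0"

definition dirichlet_eigenvalue ::
  "real \<Rightarrow> real \<Rightarrow> (real \<Rightarrow> real) \<Rightarrow> (real \<Rightarrow> real) \<Rightarrow> real \<Rightarrow> bool" where
  "dirichlet_eigenvalue p L A R lam \<longleftrightarrow>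
     (\<exists>u. dirichlet_solution p L A R lam u \<and> (\<exists>x\<in>{0..L}. u x \<noteq> 0))"

(* s 1, s 2, ... lists the elements of S in strictly increasing order of key; s 0 is irrelevant. *)
definition enumerates_by :: "(real \<Rightarrow> real) \<Rightarrow> (nat \<Rightarrow> real) \<Rightarrow> real set \<Rightarrow> bool" where
  "enumerates_by key s S \<longleftrightarrow> strict_mono_on {1..} (\<lambda>k. key (s k)) \<and> s ` {1..} = S"

definition average :: "real \<Rightarrow> (real \<Rightarrow> real) \<Rightarrow> real" where
  "average L f = 1 / L * integral {0..L} f"

(* The homogenized coefficient: the power 1 - p of the AVERAGE of a^(-1/(p-1)) over a period.
   The formula is often displayed with the plain integral over (0,L), which is the same for L = 1;
   for other L the average is needed: with a = 1 the equation has coefficient 1 for every epsilon,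
   hence so has the limit, whereas the plain integral would give L^(1-p). *)
definition homogenized_coeff :: "real \<Rightarrow> real \<Rightarrow> (real \<Rightarrow> real) \<Rightarrow> real" where
  "homogenized_coeff p L a = (average L (\<lambda>t. a t powr (- 1 / (p - 1)))) powr (1 - p)"

end

(* Put b = a^(-1/(p-1)) and q = p/(p-1). With the flux w, the equation is the quasi-homogeneous system
   u' = b phi_q(w), w' = -lam rho phi_p(u). In the coordinates u = e^k sin t, w = e^((p-1)k) cos t the
   angle solves t' = b F(t) + lam rho G(t) with F, G of class C^1 and Lipschitz, although the system
   itself is not, and lam is an eigenvalue iff t(L) is a multiple of pi. For lam > 0, replacing w by
   lam w moves the parameter to the positive coefficient: t' = lam^(1/(p-1)) b F(t) + rho G(t). Now t(L)
   is continuous and strictly increasing in lam and vanishes at lam = 0, so the k-th positive eigenvalue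
   is the solution of t(L) = k pi. For fixed lam, t(L) converges, as epsilon tends to 0, to the end value
   for the averaged coefficients: an integration by parts bounds the oscillating terms by O(epsilon), and
   a Gronwall estimate does the rest. If the average of rho is not positive, the averaged
   angle cannot pass pi/2, so the eigenvalues leave every bounded interval. Negative eigenvalues are
   positive ones for -rho. *)

theory Submission
  imports Defs
begin

section \<open>Absolutely continuous functions on an interval\<close>


text \<open>The coefficients are merely integrable, so every equation is read in integrated form.
  Two obstacles shape the proof. First, unless p = 2 one of \<open>phi p\<close>,
  \<open>phi q\<close> fails to be Lipschitz at 0, whereas an eigenfunction may be any solution of
  the planar system and must be identified, up to scaling, with the one built from the angle.
  Uniqueness is therefore proved in two charts, one where w is nonzero and one where u is nonzero,
  and an energy treats the origin. Second, the oscillating coefficients converge only weakly. They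
  enter the angle equation linearly, and the error is evaluated along the averaged solution, so that
  they are tested against F and G of one fixed angle. These test functions do not depend on epsilon
  and have integrable derivatives because F and G are of class C^1. The passage from angles to
  eigenvalues uses the limit at one fixed parameter at a time: comparing the angle with k pi there
  tells on which side of the parameter the k-th eigenvalue lies.\<close>

abbreviation AI :: "real \<Rightarrow> real \<Rightarrow> (real \<Rightarrow> real) \<Rightarrow> bool" where
  "AI a b f \<equiv> f absolutely_integrable_on {a..b}"

text \<open>This is the encoding of \<open>abs_cont_deriv\<close>, on an arbitrary interval so that
  solutions can be restricted. The derivative is carried as an integrand, so the rules of calculus
  become identities between integrals.\<close>

definition ac_on :: "real \<Rightarrow> real \<Rightarrow> (real \<Rightarrow> real) \<Rightarrow> (real \<Rightarrow> real) \<Rightarrow> bool" where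
  "ac_on a b f f' \<longleftrightarrow> AI a b f' \<and> (\<forall>x\<in>{a..b}. f x = f a + integral {a..x} f')"

section \<open>Absolute integrability: restriction, products, linear combinations\<close>

lemma AI_subinterval: "AI a b f \<Longrightarrow> a \<le> c \<Longrightarrow> d \<le> b \<Longrightarrow> AI c d f"
  by (metis absolutely_integrable_on_subinterval atLeastatMost_subset_iff)

lemma AI_integrable: "AI a b f \<Longrightarrow> f integrable_on {a..b}"
  by (rule set_lebesgue_integral_eq_integral(1))

lemma AI_integrable_sub: "AI a b f \<Longrightarrow> a \<le> c \<Longrightarrow> d \<le> b \<Longrightarrow> f integrable_on {c..d}"
  by (rule AI_integrable[OF AI_subinterval])

lemma AI_mult_bounded:
  assumes "AI a b f" "g \<in> borel_measurable (lebesgue_on {a..b})" "\<And>x. x \<in> {a..b} \<Longrightarrow> \<bar>g x\<bar> \<le> C"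
  shows "AI a b (\<lambda>x. f x * g x)"
proof -
  have "bounded (g ` {a..b})"
    unfolding bounded_iff using assms(3) by (intro exI[of _ C]) auto
  from absolutely_integrable_bounded_measurable_product_real[OF assms(2) _ this assms(1)]
  show ?thesis by (simp add: mult.commute)
qed

lemma AI_mult_continuous:
  assumes "AI a b f" "continuous_on {a..b} g"
  shows "AI a b (\<lambda>x. f x * g x)"
proof -
  have "bounded (g ` {a..b})"
    using assms(2) by (intro compact_imp_bounded compact_continuous_image) auto
  then obtain C where "\<And>x. x \<in> {a..b} \<Longrightarrow> \<bar>g x\<bar> \<le> C"
    unfolding bounded_iff by (metis imageI real_norm_def)
  moreover have "g \<in> borel_measurable (lebesgue_on {a..b})"
    by (rule continuous_imp_measurable_on_sets_lebesgue[OF assms(2)]) auto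
  ultimately show ?thesis using AI_mult_bounded[OF assms(1)] by blast
qed

lemma AI_mult_continuous_left:
  assumes "AI a b f" "continuous_on {a..b} g"
  shows "AI a b (\<lambda>x. g x * f x)"
  using AI_mult_continuous[OF assms] by (simp add: mult.commute)

lemma AI_add: "AI a b f \<Longrightarrow> AI a b g \<Longrightarrow> AI a b (\<lambda>x. f x + g x)"
  by (rule set_integral_add)
lemma AI_diff: "AI a b f \<Longrightarrow> AI a b g \<Longrightarrow> AI a b (\<lambda>x. f x - g x)"
  by (rule set_integral_diff)
lemma AI_minus: "AI a b f \<Longrightarrow> AI a b (\<lambda>x. - f x)"
  using AI_diff[of a b "\<lambda>x. 0" f] by simp
lemma AI_cmult: "AI a b f \<Longrightarrow> AI a b (\<lambda>x. c * f x)"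
  by (rule set_integrable_mult_right) 
lemma AI_abs: "AI a b f \<Longrightarrow> AI a b (\<lambda>x. \<bar>f x\<bar>)"
  by (rule set_integrable_abs)
lemma AI_const: "AI a b (\<lambda>x. c)"
  by (rule absolutely_integrable_continuous_real) auto

lemma AI_spike:
  assumes "AI a b f" "negligible N" "\<And>x. x \<in> {a..b} - N \<Longrightarrow> g x = f x"
  shows "AI a b g"
  using absolutely_integrable_spike[OF assms(1,2)] assms(3) by auto

lemma integral_abs_le:
  assumes "AI a b f" "a \<le> c" "d \<le> b"
  shows "\<bar>integral {c..d} f\<bar> \<le> integral {c..d} (\<lambda>x. \<bar>f x\<bar>)"
  using integral_norm_bound_integral[of f "{c..d}" "\<lambda>x. \<bar>f x\<bar>"]
    AI_integrable_sub[OF assms] AI_integrable_sub[OF AI_abs[OF assms(1)] assms(2,3)] by auto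

section \<open>Calculus of absolutely continuous functions\<close>

lemma ac_on_AI: "ac_on a b f f' \<Longrightarrow> AI a b f'"
  by (simp add: ac_on_def)

lemma ac_onD: "ac_on a b f f' \<Longrightarrow> x \<in> {a..b} \<Longrightarrow> f x = f a + integral {a..x} f'"
  unfolding ac_on_def by blast

lemma ac_onI:
  assumes "AI a b f'" "\<And>x. x \<in> {a..b} \<Longrightarrow> f x = f a + integral {a..x} f'"
  shows "ac_on a b f f'"
  unfolding ac_on_def using assms by blast

lemma ac_on_diff_eq:
  assumes "ac_on a b f f'" "a \<le> s" "s \<le> t" "t \<le> b"
  shows "f t - f s = integral {s..t} f'"
proof -
  have "integral {a..s} f' + integral {s..t} f' = integral {a..t} f'"
    by (rule Henstock_Kurzweil_Integration.integral_combine) (use assms AI_integrable_sub[OF ac_on_AI[OF assms(1)]] in auto)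
  moreover have "f t = f a + integral {a..t} f'" "f s = f a + integral {a..s} f'"
    by (rule ac_onD[OF assms(1)]; use assms in auto)+
  ultimately show ?thesis by simp
qed

lemma ac_on_subinterval:
  assumes "ac_on a b f f'" "a \<le> c" "d \<le> b"
  shows "ac_on c d f f'"
  unfolding ac_on_def
proof (intro conjI ballI)
  show "AI c d f'" by (rule AI_subinterval[OF ac_on_AI[OF assms(1)] assms(2,3)])
  fix x assume "x \<in> {c..d}"
  then show "f x = f c + integral {c..x} f'"
    using ac_on_diff_eq[OF assms(1), of c x] assms(2,3) by auto
qed

lemma ac_on_continuous:
  assumes "ac_on a b f f'"
  shows "continuous_on {a..b} f"
proof -
  have "continuous_on {a..b} (\<lambda>x. f a + integral {a..x} f')"
    by (intro continuous_intros indefinite_integral_continuous_1 AI_integrable ac_on_AI[OF assms])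
  then show ?thesis
    by (rule continuous_on_eq) (rule ac_onD[OF assms, symmetric])
qed

lemma ac_on_integral: "AI a b f' \<Longrightarrow> ac_on a b (\<lambda>x. c + integral {a..x} f') f'"
  by (rule ac_onI) auto

lemma ac_on_spike:
  assumes "ac_on a b f f'" "negligible N" "\<And>x. x \<in> {a..b} - N \<Longrightarrow> g' x = f' x"
    and "\<And>x. x \<in> {a..b} \<Longrightarrow> g x = f x"
  shows "ac_on a b g g'"
  unfolding ac_on_def
proof (intro conjI ballI)
  show "AI a b g'" using AI_spike[OF ac_on_AI[OF assms(1)] assms(2,3)] .
  fix x assume x: "x \<in> {a..b}"
  have "integral {a..x} f' = integral {a..x} g'"
    by (rule integral_spike[OF assms(2)]) (use assms(3) x in auto)
  then show "g x = g a + integral {a..x} g'"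
    using ac_onD[OF assms(1) x] assms(4)[OF x] assms(4)[of a] x by simp
qed

lemma ac_on_cong:
  assumes "ac_on a b f f'" "\<And>x. x \<in> {a..b} \<Longrightarrow> g' x = f' x" "\<And>x. x \<in> {a..b} \<Longrightarrow> g x = f x"
  shows "ac_on a b g g'"
  using ac_on_spike[OF assms(1) negligible_empty] assms(2,3) by auto

lemma ac_on_add: "ac_on a b f f' \<Longrightarrow> ac_on a b g g' \<Longrightarrow> ac_on a b (\<lambda>x. f x + g x) (\<lambda>x. f' x + g' x)"
  unfolding ac_on_def
proof (elim conjE, intro conjI ballI)
  assume *: "AI a b f'" "AI a b g'" "\<forall>x\<in>{a..b}. f x = f a + integral {a..x} f'"
    "\<forall>x\<in>{a..b}. g x = g a + integral {a..x} g'"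
  show "AI a b (\<lambda>x. f' x + g' x)" using * by (intro AI_add)
  fix x assume x: "x \<in> {a..b}"
  have "integral {a..x} (\<lambda>x. f' x + g' x) = integral {a..x} f' + integral {a..x} g'"
    by (rule integral_add; rule AI_integrable_sub) (use *(1,2) x in auto)
  then show "f x + g x = f a + g a + integral {a..x} (\<lambda>x. f' x + g' x)"
    using bspec[OF *(3) x] bspec[OF *(4) x] by simp
qed

lemma ac_on_cmult: "ac_on a b f f' \<Longrightarrow> ac_on a b (\<lambda>x. c * f x) (\<lambda>x. c * f' x)"
  by (rule ac_onI, rule AI_cmult, erule ac_on_AI, drule (1) ac_onD) (simp flip: ring_distribs)

lemma ac_on_minus: "ac_on a b f f' \<Longrightarrow> ac_on a b (\<lambda>x. - f x) (\<lambda>x. - f' x)"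
  using ac_on_cmult[of a b f f' "-1"] by simp

lemma ac_on_diff: "ac_on a b f f' \<Longrightarrow> ac_on a b g g' \<Longrightarrow> ac_on a b (\<lambda>x. f x - g x) (\<lambda>x. f' x - g' x)"
  using ac_on_add[OF _ ac_on_minus, of a b f f' g g'] by simp

lemma ac_on_const: "ac_on a b (\<lambda>x. c) (\<lambda>x. 0)"
  by (simp add: ac_on_def AI_const)

text \<open>A candidate derivative only has to be tested near each point. Increments of
  \<open>h\<close> and both integrals are additive over adjacent intervals, so bisection glues the
  local estimates into one over the whole interval, with total error \<open>\<eta>\<close> times the
  integral of \<open>m\<close>; then \<open>\<eta>\<close> tends to 0.\<close>

lemma ac_onI_local:
  assumes g: "AI a b g" and m: "AI a b m" "\<And>x. x \<in> {a..b} \<Longrightarrow> 0 \<le> m x"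
    and loc: "\<And>\<eta> x. 0 < \<eta> \<Longrightarrow> x \<in> {a..b} \<Longrightarrow>
      \<exists>\<delta>>0. \<forall>s t. a \<le> s \<and> s \<le> x \<and> x \<le> t \<and> t \<le> b \<and> t - s < \<delta> \<longrightarrow>
        \<bar>h t - h s - integral {s..t} g\<bar> \<le> \<eta> * integral {s..t} m"
  shows "ac_on a b h g"
  unfolding ac_on_def
proof (intro conjI ballI g)
  fix c assume c: "c \<in> {a..b}"
  have bound: "\<bar>h c - h a - integral {a..c} g\<bar> \<le> \<eta> * integral {a..c} m" if \<eta>: "0 < \<eta>" for \<eta>
  proof -
    \<comment> \<open>The premises inside \<open>P\<close> confine the estimate to subintervals of
      \<open>{a..c}\<close>, since the bisection principle quantifies over all s and t around a
      point.\<close>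
    define P where "P s t \<longleftrightarrow> (a \<le> s \<and> t \<le> c \<and> s \<le> t \<longrightarrow>
      \<bar>h t - h s - integral {s..t} g\<bar> \<le> \<eta> * integral {s..t} m)" for s t
    have "P a c"
    proof (rule Bolzano)
      show "a \<le> c" using c by auto
      fix x y z assume *: "P x y" "P y z" "x \<le> y" "y \<le> z"
      show "P x z"
        unfolding P_def
      proof
        assume xz: "a \<le> x \<and> z \<le> c \<and> x \<le> z"
        have "integral {x..y} g + integral {y..z} g = integral {x..z} g"
          "integral {x..y} m + integral {y..z} m = integral {x..z} m"
          by (rule Henstock_Kurzweil_Integration.integral_combine; use * xz c AI_integrable_sub g m in auto)+
        moreover have "\<bar>h y - h x - integral {x..y} g\<bar> \<le> \<eta> * integral {x..y} m"
          "\<bar>h z - h y - integral {y..z} g\<bar> \<le> \<eta> * integral {y..z} m"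
          using * xz by (auto simp: P_def)
        moreover have "\<eta> * integral {x..z} m = \<eta> * integral {x..y} m + \<eta> * integral {y..z} m"
          unfolding calculation(2)[symmetric] by (rule distrib_left)
        ultimately show "\<bar>h z - h x - integral {x..z} g\<bar> \<le> \<eta> * integral {x..z} m"
          by linarith
      qed
    next
      fix x assume x: "a \<le> x" "x \<le> c"
      then obtain d where "d > 0" "\<forall>s t. a \<le> s \<and> s \<le> x \<and> x \<le> t \<and> t \<le> b \<and> t - s < d \<longrightarrow>
        \<bar>h t - h s - integral {s..t} g\<bar> \<le> \<eta> * integral {s..t} m"
        using loc[OF \<eta>, of x] c by auto
      then show "\<exists>d>0. \<forall>s t. s \<le> x \<and> x \<le> t \<and> t - s < d \<longrightarrow> P s t"
        unfolding P_def using c by (intro exI[of _ d]) auto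
    qed
    then show ?thesis using c by (auto simp: P_def)
  qed
  have "\<bar>h c - h a - integral {a..c} g\<bar> \<le> 0"
  proof (rule field_le_epsilon)
    fix e :: real assume e: "0 < e"
    have M: "0 \<le> integral {a..c} m"
      using c m by (intro integral_nonneg) (auto intro: AI_integrable_sub)
    \<comment> \<open>The summand 1 keeps the denominator positive when \<open>m\<close> integrates
      to 0.\<close>
    have "\<bar>h c - h a - integral {a..c} g\<bar> \<le> e / (integral {a..c} m + 1) * integral {a..c} m"
      by (rule bound) (use e M in auto)
    also have "\<dots> \<le> e"
      using e M by (simp add: field_simps)
    finally show "\<bar>h c - h a - integral {a..c} g\<bar> \<le> 0 + e" by simp
  qed
  then show "h c = h a + integral {a..c} g" by simp
qed

lemma ac_on_chain:
  assumes f: "ac_on a b f f'"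
    and D: "\<And>x. x \<in> {a..b} \<Longrightarrow> (g has_real_derivative g' (f x)) (at (f x))"
    and C: "continuous_on {a..b} (\<lambda>x. g' (f x))"
  shows "ac_on a b (\<lambda>x. g (f x)) (\<lambda>x. g' (f x) * f' x)"
proof (rule ac_onI_local)
  show AI': "AI a b (\<lambda>x. g' (f x) * f' x)"
    by (rule AI_mult_continuous_left[OF ac_on_AI[OF f] C])
  show AIm: "AI a b (\<lambda>x. \<bar>f' x\<bar>)" by (rule AI_abs[OF ac_on_AI[OF f]])
  show "0 \<le> \<bar>f' x\<bar>" for x by simp
  fix \<eta> x :: real assume \<eta>: "0 < \<eta>" and x: "x \<in> {a..b}"
  have "\<forall>e>0. \<exists>d>0. \<forall>y. norm (y - f x) < d \<longrightarrow> norm (g y - g (f x) - g' (f x) * (y - f x)) \<le> e * norm (y - f x)"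
    using D[OF x] by (simp add: has_field_derivative_def has_derivative_at_alt)
  then obtain d1 where d1: "d1 > 0" and d1': "\<And>y. \<bar>y - f x\<bar> < d1 \<Longrightarrow> \<bar>g y - g (f x) - g' (f x) * (y - f x)\<bar> \<le> \<eta>/2 * \<bar>y - f x\<bar>"
    using \<eta> half_gt_zero[OF \<eta>] unfolding real_norm_def by blast
  obtain d2 where d2: "d2 > 0" "\<And>y. y \<in> {a..b} \<Longrightarrow> \<bar>y - x\<bar> < d2 \<Longrightarrow> \<bar>f y - f x\<bar> < d1"
    using ac_on_continuous[OF f] x d1 unfolding continuous_on_iff dist_real_def by meson
  have "\<eta>/2 > 0" using \<eta> by simp
  then obtain d3 where d3: "d3 > 0" "\<And>y. y \<in> {a..b} \<Longrightarrow> \<bar>y - x\<bar> < d3 \<Longrightarrow> \<bar>g' (f y) - g' (f x)\<bar> < \<eta>/2"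
    using C x unfolding continuous_on_iff dist_real_def by meson
  show "\<exists>\<delta>>0. \<forall>s t. a \<le> s \<and> s \<le> x \<and> x \<le> t \<and> t \<le> b \<and> t - s < \<delta> \<longrightarrow>
        \<bar>g (f t) - g (f s) - integral {s..t} (\<lambda>x. g' (f x) * f' x)\<bar> \<le> \<eta> * integral {s..t} (\<lambda>x. \<bar>f' x\<bar>)"
  proof (intro exI[of _ "min d2 d3"] conjI allI impI)
    show "min d2 d3 > 0" using d2 d3 by simp
    fix s t assume st: "a \<le> s \<and> s \<le> x \<and> x \<le> t \<and> t \<le> b \<and> t - s < min d2 d3"
    note I = AI_integrable_sub[OF AIm] AI_integrable_sub[OF AI'] AI_integrable_sub[OF ac_on_AI[OF f]]
    have c: "integral {s..x} (\<lambda>x. \<bar>f' x\<bar>) + integral {x..t} (\<lambda>x. \<bar>f' x\<bar>) = integral {s..t} (\<lambda>x. \<bar>f' x\<bar>)"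
      by (rule Henstock_Kurzweil_Integration.integral_combine) (use st I in auto)
    have 1: "\<bar>g (f t) - g (f x) - g' (f x) * (f t - f x)\<bar> \<le> \<eta>/2 * integral {x..t} (\<lambda>x. \<bar>f' x\<bar>)"
    proof -
      have "\<bar>f t - f x\<bar> \<le> integral {x..t} (\<lambda>x. \<bar>f' x\<bar>)"
        using ac_on_diff_eq[OF f, of x t] st integral_abs_le[OF ac_on_AI[OF f], of x t] x by auto
      then have "\<eta>/2 * \<bar>f t - f x\<bar> \<le> \<eta>/2 * integral {x..t} (\<lambda>x. \<bar>f' x\<bar>)"
        using \<eta> by (intro mult_left_mono) auto
      moreover have "\<bar>g (f t) - g (f x) - g' (f x) * (f t - f x)\<bar> \<le> \<eta>/2 * \<bar>f t - f x\<bar>"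
        by (intro d1' d2) (use st x in auto)
      ultimately show ?thesis by linarith
    qed
    have 2: "\<bar>g (f s) - g (f x) - g' (f x) * (f s - f x)\<bar> \<le> \<eta>/2 * integral {s..x} (\<lambda>x. \<bar>f' x\<bar>)"
    proof -
      have "\<bar>f s - f x\<bar> \<le> integral {s..x} (\<lambda>x. \<bar>f' x\<bar>)"
        using ac_on_diff_eq[OF f, of s x] st integral_abs_le[OF ac_on_AI[OF f], of s x] x by auto
      then have "\<eta>/2 * \<bar>f s - f x\<bar> \<le> \<eta>/2 * integral {s..x} (\<lambda>x. \<bar>f' x\<bar>)"
        using \<eta> by (intro mult_left_mono) auto
      moreover have "\<bar>g (f s) - g (f x) - g' (f x) * (f s - f x)\<bar> \<le> \<eta>/2 * \<bar>f s - f x\<bar>"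
        by (intro d1' d2) (use st x in auto)
      ultimately show ?thesis by linarith
    qed
    have 3: "\<bar>g' (f x) * (f t - f s) - integral {s..t} (\<lambda>x. g' (f x) * f' x)\<bar> \<le> \<eta>/2 * integral {s..t} (\<lambda>x. \<bar>f' x\<bar>)"
    proof -
      have "g' (f x) * (f t - f s) - integral {s..t} (\<lambda>x. g' (f x) * f' x)
          = integral {s..t} (\<lambda>y. g' (f x) * f' y - g' (f y) * f' y)"
        using ac_on_diff_eq[OF f, of s t] st I
        by (subst integral_diff[OF integrable_on_mult_right]) auto
      moreover have "norm (integral {s..t} (\<lambda>y. g' (f x) * f' y - g' (f y) * f' y)) \<le> integral {s..t} (\<lambda>y. \<eta>/2 * \<bar>f' y\<bar>)"
      proof (rule integral_norm_bound_integral)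
        show "(\<lambda>y. g' (f x) * f' y - g' (f y) * f' y) integrable_on {s..t}"
          using I st by (intro integrable_diff integrable_on_mult_right) auto
        show "(\<lambda>y. \<eta>/2 * \<bar>f' y\<bar>) integrable_on {s..t}" 
          using I st by (intro integrable_on_mult_right) auto
        fix y assume y: "y \<in> {s..t}"
        have "\<bar>g' (f y) - g' (f x)\<bar> < \<eta>/2" using d3(2)[of y] y st by auto
        then have "\<bar>g' (f x) - g' (f y)\<bar> * \<bar>f' y\<bar> \<le> \<eta>/2 * \<bar>f' y\<bar>"
          by (intro mult_right_mono) (auto simp: abs_minus_commute)
        then show "norm (g' (f x) * f' y - g' (f y) * f' y) \<le> \<eta>/2 * \<bar>f' y\<bar>"
          by (simp add: abs_mult[symmetric] left_diff_distrib)
      qed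
      ultimately show ?thesis by simp
    qed
    have "g (f t) - g (f s) - integral {s..t} (\<lambda>x. g' (f x) * f' x)
      = (g (f t) - g (f x) - g' (f x) * (f t - f x)) - (g (f s) - g (f x) - g' (f x) * (f s - f x))
        + (g' (f x) * (f t - f s) - integral {s..t} (\<lambda>x. g' (f x) * f' x))"
      by (simp add: algebra_simps)
    then have "\<bar>g (f t) - g (f s) - integral {s..t} (\<lambda>x. g' (f x) * f' x)\<bar>
      \<le> \<eta>/2 * integral {x..t} (\<lambda>x. \<bar>f' x\<bar>) + \<eta>/2 * integral {s..x} (\<lambda>x. \<bar>f' x\<bar>) + \<eta>/2 * integral {s..t} (\<lambda>x. \<bar>f' x\<bar>)"
      using 1 2 3 by linarith
    also have "\<dots> = \<eta> * integral {s..t} (\<lambda>x. \<bar>f' x\<bar>)"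
      unfolding c[symmetric] by (simp add: algebra_simps)
    finally show "\<bar>g (f t) - g (f s) - integral {s..t} (\<lambda>x. g' (f x) * f' x)\<bar> \<le> \<eta> * integral {s..t} (\<lambda>x. \<bar>f' x\<bar>)" .
  qed
qed

text \<open>Polarization reduces the product to squares, which the chain rule covers.\<close>

lemma ac_on_mult:
  assumes f: "ac_on a b f f'" and g: "ac_on a b g g'"
  shows "ac_on a b (\<lambda>x. f x * g x) (\<lambda>x. f' x * g x + f x * g' x)"
proof -
  have sq: "ac_on a b (\<lambda>x. (h x)^2) (\<lambda>x. 2 * h x * h' x)" if "ac_on a b h h'" for h h'
    by (rule ac_on_chain[OF that, of "\<lambda>y. y^2" "\<lambda>y. 2 * y"])
      (use ac_on_continuous[OF that] in \<open>auto intro!: derivative_eq_intros continuous_intros\<close>)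
  have "ac_on a b (\<lambda>x. (1/4) * ((f x + g x)^2 - (f x - g x)^2))
     (\<lambda>x. (1/4) * (2 * (f x + g x) * (f' x + g' x) - 2 * (f x - g x) * (f' x - g' x)))"
    by (intro ac_on_cmult ac_on_diff sq ac_on_add f g)
  then show ?thesis
    by (rule ac_on_cong) (simp_all add: algebra_simps power2_eq_square)
qed

lemma ac_on_exp_integral:
  assumes k: "AI a b k"
  shows "ac_on a b (\<lambda>x. exp (c * integral {a..x} k)) (\<lambda>x. c * k x * exp (c * integral {a..x} k))"
proof -
  have "ac_on a b (\<lambda>x. c * (0 + integral {a..x} k)) (\<lambda>x. c * k x)"
    by (intro ac_on_cmult ac_on_integral k)
  then have i: "ac_on a b (\<lambda>x. c * integral {a..x} k) (\<lambda>x. c * k x)" by simp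
  have "ac_on a b (\<lambda>x. exp (c * integral {a..x} k)) (\<lambda>x. exp (c * integral {a..x} k) * (c * k x))"
    by (rule ac_on_chain[OF i, of exp exp])
      (use ac_on_continuous[OF i] in \<open>auto intro!: derivative_eq_intros continuous_intros\<close>)
  then show ?thesis by (rule ac_on_cong) auto
qed

section \<open>Linear equations: integrating factor, sign, Gronwall bound\<close>

lemma linear_ode:
  assumes d: "ac_on a b d (\<lambda>x. k x * d x + h x)" and k: "AI a b k" and h: "AI a b h"
    and x: "x \<in> {a..b}"
  shows "d x * exp (- integral {a..x} k) = d a + integral {a..x} (\<lambda>t. h t * exp (- integral {a..t} k))"
proof -
  define e where "e x = exp (-1 * integral {a..x} k)" for x
  have e: "ac_on a b e (\<lambda>x. -1 * k x * e x)"
    unfolding e_def by (rule ac_on_exp_integral[OF k])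
  have "ac_on a b (\<lambda>x. d x * e x) (\<lambda>x. h x * e x)"
    by (rule ac_on_cong[OF ac_on_mult[OF d e]]) (auto simp: algebra_simps)
  then have "d x * e x = d a * e a + integral {a..x} (\<lambda>t. h t * e t)"
    by (rule ac_onD[OF _ x])
  then show ?thesis by (simp add: e_def)
qed

lemma linear_ode_zero:
  assumes d: "ac_on a b d (\<lambda>x. k x * d x)" and k: "AI a b k" and "d a = 0" and x: "x \<in> {a..b}"
  shows "d x = 0"
  using linear_ode[of a b d k "\<lambda>_. 0" x] assms AI_const[of a b 0] by simp

lemma linear_ode_nonneg:
  assumes d: "ac_on a b d (\<lambda>x. k x * d x + h x)" and k: "AI a b k" and h: "AI a b h"
    and "0 \<le> d a" "\<And>t. t \<in> {a..b} \<Longrightarrow> 0 \<le> h t" and x: "x \<in> {a..b}"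
  shows "0 \<le> d x"
proof -
  have c: "continuous_on {a..b} (\<lambda>t. exp (- integral {a..t} k))"
    by (intro continuous_intros indefinite_integral_continuous_1 AI_integrable k)
  have "0 \<le> integral {a..x} (\<lambda>t. h t * exp (- integral {a..t} k))"
    by (rule integral_nonneg) (use assms AI_integrable_sub[OF AI_mult_continuous[OF h c]] in auto)
  then have "0 \<le> d x * exp (- integral {a..x} k)"
    using linear_ode[OF d k h x] assms by simp
  then show ?thesis by (simp add: zero_le_mult_iff)
qed

text \<open>The factor exp (2 K) is exp K twice: once for the integrating factor under the integral,
  once for dividing by it at x.\<close>

lemma linear_ode_bound:
  assumes d: "ac_on a b d (\<lambda>x. k x * d x + h x)" and k: "AI a b k" and h: "AI a b h"
    and d0: "d a = 0" and K: "integral {a..b} (\<lambda>t. \<bar>k t\<bar>) \<le> K" and x: "x \<in> {a..b}"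
  shows "\<bar>d x\<bar> \<le> exp (2 * K) * integral {a..b} (\<lambda>t. \<bar>h t\<bar>)"
proof -
  have c: "continuous_on {a..b} (\<lambda>t. exp (- integral {a..t} k))"
    by (intro continuous_intros indefinite_integral_continuous_1 AI_integrable k)
  have kk: "\<bar>integral {a..t} k\<bar> \<le> K" if "t \<in> {a..b}" for t
  proof -
    have "integral {a..t} (\<lambda>t. \<bar>k t\<bar>) \<le> integral {a..b} (\<lambda>t. \<bar>k t\<bar>)"
      by (rule integral_subset_le) (use that AI_integrable_sub[OF AI_abs[OF k]] in auto)
    then show ?thesis using integral_abs_le[OF k, of a t] K that by simp
  qed
  have "\<bar>integral {a..x} (\<lambda>t. h t * exp (- integral {a..t} k))\<bar> \<le> integral {a..x} (\<lambda>t. exp K * \<bar>h t\<bar>)"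
    using integral_norm_bound_integral[of "\<lambda>t. h t * exp (- integral {a..t} k)" "{a..x}" "\<lambda>t. exp K * \<bar>h t\<bar>"]
  proof -
    have "\<bar>h t * exp (- integral {a..t} k)\<bar> \<le> exp K * \<bar>h t\<bar>" if "t \<in> {a..x}" for t
    proof -
      have "\<bar>h t\<bar> * exp (- integral {a..t} k) \<le> \<bar>h t\<bar> * exp K"
        using kk[of t] that x by (intro mult_left_mono) auto
      then show ?thesis by (simp add: abs_mult mult.commute)
    qed
    moreover have "(\<lambda>t. h t * exp (- integral {a..t} k)) integrable_on {a..x}"
      by (rule AI_integrable_sub[OF AI_mult_continuous[OF h c]]) (use x in auto)
    moreover have "(\<lambda>t. exp K * \<bar>h t\<bar>) integrable_on {a..x}"
      by (rule AI_integrable_sub[OF AI_cmult[OF AI_abs[OF h]]]) (use x in auto)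
    ultimately show ?thesis
      using integral_norm_bound_integral[of "\<lambda>t. h t * exp (- integral {a..t} k)" "{a..x}" "\<lambda>t. exp K * \<bar>h t\<bar>"] by auto
  qed
  also have "\<dots> \<le> exp K * integral {a..b} (\<lambda>t. \<bar>h t\<bar>)"
  proof -
    have "integral {a..x} (\<lambda>t. \<bar>h t\<bar>) \<le> integral {a..b} (\<lambda>t. \<bar>h t\<bar>)"
      by (rule integral_subset_le) (use x AI_integrable_sub[OF AI_abs[OF h]] in auto)
    then show ?thesis by simp
  qed
  finally have 1: "\<bar>d x * exp (- integral {a..x} k)\<bar> \<le> exp K * integral {a..b} (\<lambda>t. \<bar>h t\<bar>)"
    using linear_ode[OF d k h x] d0 by simp
  define I where "I = integral {a..x} k"
  define H where "H = integral {a..b} (\<lambda>t. \<bar>h t\<bar>)"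
  have H: "0 \<le> H"
    unfolding H_def by (rule integral_nonneg[OF AI_integrable[OF AI_abs[OF h]]]) simp
  have I: "exp I \<le> exp K" using abs_le_D1[OF kk[OF x]] by (simp add: I_def)
  have "\<bar>d x\<bar> = \<bar>d x * exp (- I)\<bar> * exp I"
    by (simp add: abs_mult mult.assoc exp_minus)
  then have "\<bar>d x\<bar> \<le> (exp K * H) * exp K"
    using mult_mono[OF 1[folded I_def H_def] I] H by simp
  moreover have "exp (2 * K) = exp K * exp K" by (simp only: mult_2 exp_add)
  ultimately show ?thesis
    by (simp only: H_def mult_ac)
qed

section \<open>Scalar equations for the angle\<close>


lemma Lipschitz_continuous_on:
  fixes f :: "real \<Rightarrow> real"
  assumes "\<And>x y. \<bar>f x - f y\<bar> \<le> C * \<bar>x - y\<bar>"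
  shows "continuous_on S f"
proof -
  have "C \<ge> 0" using assms[of 1 0] by (simp add: order_trans[OF abs_ge_zero])
  then have "C-lipschitz_on S f"
    using assms by (auto intro!: lipschitz_onI simp: dist_real_def)
  then show ?thesis by (rule lipschitz_on_continuous_on)
qed

text \<open>Boundedness together with the global Lipschitz condition gives solutions on the whole
  interval for coefficients that are only integrable. One constant serves all four bounds.\<close>

locale angle_field =
  fixes F G :: "real \<Rightarrow> real" and C :: real
  assumes F_lip: "\<bar>F x - F y\<bar> \<le> C * \<bar>x - y\<bar>" and G_lip: "\<bar>G x - G y\<bar> \<le> C * \<bar>x - y\<bar>"
    and F_bound: "\<bar>F x\<bar> \<le> C" and G_bound: "\<bar>G x\<bar> \<le> C"
begin

definition angle_ode :: "real \<Rightarrow> (real \<Rightarrow> real) \<Rightarrow> (real \<Rightarrow> real) \<Rightarrow> (real \<Rightarrow> real) \<Rightarrow> bool" where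
  "angle_ode L B R \<theta> \<longleftrightarrow> ac_on 0 L \<theta> (\<lambda>x. B x * F (\<theta> x) + R x * G (\<theta> x))"

definition angle_sol :: "real \<Rightarrow> (real \<Rightarrow> real) \<Rightarrow> (real \<Rightarrow> real) \<Rightarrow> (real \<Rightarrow> real) \<Rightarrow> bool" where
  "angle_sol L B R \<theta> \<longleftrightarrow> angle_ode L B R \<theta> \<and> \<theta> 0 = 0"

lemma angle_sol_ode: "angle_sol L B R \<theta> \<Longrightarrow> angle_ode L B R \<theta>"
  by (simp add: angle_sol_def)

lemma angle_sol_ac: "angle_sol L B R \<theta> \<Longrightarrow> ac_on 0 L \<theta> (\<lambda>x. B x * F (\<theta> x) + R x * G (\<theta> x))"
  by (simp add: angle_sol_def angle_ode_def)

lemma C_nonneg: "0 \<le> C"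
  using F_bound[of 0] by linarith

lemma cont_F: "continuous_on S F" and cont_G: "continuous_on S G"
  using F_lip G_lip by (auto intro!: Lipschitz_continuous_on)

lemma AI_field:
  assumes "AI 0 L B" "AI 0 L R" "continuous_on {0..L} \<theta>"
  shows "AI 0 L (\<lambda>x. B x * F (\<theta> x) + R x * G (\<theta> x))"
  by (intro AI_add AI_mult_continuous assms continuous_on_compose2[OF cont_F] continuous_on_compose2[OF cont_G])
    auto

lemma angle_sol_exists:
  assumes L: "0 < L" and B: "AI 0 L B" and R: "AI 0 L R"
  shows "\<exists>\<theta>. angle_sol L B R \<theta>"
proof -
  \<comment> \<open>The weight E makes the Picard operator a contraction on the whole interval.\<close>
  define m where "m t = C * (\<bar>B t\<bar> + \<bar>R t\<bar>)" for t
  define E where "E x = exp (2 * integral {0..x} m)" for x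
  \<comment> \<open>Clamping the argument to [0, L] extends the operator to functions on the whole
    line, so that it acts on the complete space of bounded continuous functions.\<close>
  define c where "c x = max 0 (min L x)" for x :: real
  have c: "c x \<in> {0..L}" for x using L by (auto simp: c_def)
  have cc: "continuous_on S c" for S by (auto simp: c_def intro!: continuous_intros)
  have c_id: "x \<in> {0..L} \<Longrightarrow> c x = x" for x by (auto simp: c_def)
  have m: "AI 0 L m" unfolding m_def by (intro AI_cmult AI_add AI_abs B R)
  have Eac: "ac_on 0 L E (\<lambda>x. 2 * m x * E x)"
    unfolding E_def by (rule ac_on_exp_integral[OF m])
  have Ec: "continuous_on {0..L} E" by (rule ac_on_continuous[OF Eac])
  have E0: "E x > 0" for x by (simp add: E_def)
  \<comment> \<open>The unknown is the angle divided by \<open>E\<close>: its sup norm is the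
    weighted norm of the angle.\<close>
  define \<Phi> where "\<Phi> \<psi> t = B t * F (E t * \<psi> t) + R t * G (E t * \<psi> t)" for \<psi> t
  define T where "T \<psi> x = integral {0..c x} (\<Phi> \<psi>) / E (c x)" for \<psi> x
  have \<Phi>: "AI 0 L (\<Phi> \<psi>)" if "continuous_on {0..L} \<psi>" for \<psi>
    unfolding \<Phi>_def by (rule AI_field[OF B R]) (intro continuous_intros Ec that)
  have T: "T \<psi> \<in> bcontfun" if "continuous_on {0..L} \<psi>" for \<psi>
  proof -
    have k: "continuous_on {0..L} (\<lambda>x. integral {0..x} (\<Phi> \<psi>) / E x)"
      using E0 by (intro continuous_intros indefinite_integral_continuous_1 AI_integrable \<Phi> that Ec) (simp add: less_imp_neq[THEN not_sym])
    have "continuous_on UNIV (T \<psi>)"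
      unfolding T_def by (rule continuous_on_compose2[OF k cc]) (use c in auto)
    moreover have "range (T \<psi>) \<subseteq> (\<lambda>x. integral {0..x} (\<Phi> \<psi>) / E x) ` {0..L}"
      unfolding T_def using c by auto
    then have "bounded (range (T \<psi>))"
      by (rule bounded_subset[rotated]) (intro compact_imp_bounded compact_continuous_image k compact_Icc)
    ultimately show ?thesis by (simp add: bcontfun_def)
  qed
  have contr: "\<bar>T f x - T g x\<bar> \<le> 1/2 * d"
    if f: "continuous_on {0..L} f" and g: "continuous_on {0..L} g"
      and d: "\<And>t. \<bar>f t - g t\<bar> \<le> d" for f g d x
  proof -
    define y where "y = c x"
    have y: "y \<in> {0..L}" using c by (simp add: y_def)
    have d0: "0 \<le> d" using d[of 0] by linarith
    have "norm (integral {0..y} (\<lambda>t. \<Phi> f t - \<Phi> g t)) \<le> integral {0..y} (\<lambda>t. d/2 * (2 * m t * E t))"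
    proof (rule integral_norm_bound_integral)
      show "(\<lambda>t. \<Phi> f t - \<Phi> g t) integrable_on {0..y}"
        by (rule AI_integrable_sub[OF AI_diff[OF \<Phi>[OF f] \<Phi>[OF g]]]) (use y in auto)
      show "(\<lambda>t. d/2 * (2 * m t * E t)) integrable_on {0..y}"
        by (rule AI_integrable_sub[OF AI_cmult[OF ac_on_AI[OF Eac]]]) (use y in auto)
      fix t assume "t \<in> {0..y}"
      have lip: "\<bar>H (E t * f t) - H (E t * g t)\<bar> \<le> C * (E t * d)"
        if "\<And>x y. \<bar>H x - H y\<bar> \<le> C * \<bar>x - y\<bar>" for H :: "real \<Rightarrow> real"
      proof -
        have "\<bar>H (E t * f t) - H (E t * g t)\<bar> \<le> C * \<bar>E t * f t - E t * g t\<bar>" by (rule that)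
        also have "\<bar>E t * f t - E t * g t\<bar> = E t * \<bar>f t - g t\<bar>"
          using E0[of t] by (simp add: right_diff_distrib[symmetric] abs_mult)
        also have "C * (E t * \<bar>f t - g t\<bar>) \<le> C * (E t * d)"
          using d[of t] E0[of t] C_nonneg by (intro mult_left_mono) auto
        finally show ?thesis .
      qed
      have "\<Phi> f t - \<Phi> g t = B t * (F (E t * f t) - F (E t * g t)) + R t * (G (E t * f t) - G (E t * g t))"
        by (simp add: \<Phi>_def algebra_simps)
      also have "\<bar>\<dots>\<bar> \<le> \<bar>B t\<bar> * (C * (E t * d)) + \<bar>R t\<bar> * (C * (E t * d))"
        by (intro order_trans[OF abs_triangle_ineq] add_mono) (auto simp: abs_mult intro!: mult_left_mono lip F_lip G_lip)
      finally show "norm (\<Phi> f t - \<Phi> g t) \<le> d/2 * (2 * m t * E t)"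
        by (simp add: m_def algebra_simps)
    qed
    \<comment> \<open>The integrand is d/2 times the derivative of \<open>E\<close>. The 2 in the
      exponent of \<open>E\<close> is what yields the contraction factor 1/2.\<close>
    also have "integral {0..y} (\<lambda>t. d/2 * (2 * m t * E t)) = d/2 * (E y - E 0)"
    proof -
      have "integral {0..y} (\<lambda>t. d/2 * (2 * m t * E t)) = d/2 * integral {0..y} (\<lambda>t. 2 * m t * E t)"
        by (rule integral_mult_right)
      then show ?thesis using ac_on_diff_eq[OF Eac, of 0 y] y by simp
    qed
    also have "\<dots> \<le> d/2 * E y"
      using d0 E0[of 0] by (intro mult_left_mono) auto
    finally have "\<bar>integral {0..y} (\<lambda>t. \<Phi> f t - \<Phi> g t)\<bar> \<le> d/2 * E y" by simp
    moreover have "T f x - T g x = integral {0..y} (\<lambda>t. \<Phi> f t - \<Phi> g t) / E y"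
      unfolding T_def y_def[symmetric] diff_divide_distrib[symmetric]
      by (subst integral_diff) (use y AI_integrable_sub[OF \<Phi>] f g in auto)
    ultimately show ?thesis
      using E0[of y] by (simp only: abs_divide) (simp add: divide_le_eq)
  qed
  define TT :: "(real \<Rightarrow>\<^sub>C real) \<Rightarrow> (real \<Rightarrow>\<^sub>C real)" where "TT \<psi> = Bcontfun (T (apply_bcontfun \<psi>))" for \<psi>
  have TT: "apply_bcontfun (TT \<psi>) = T (apply_bcontfun \<psi>)" for \<psi>
    unfolding TT_def by (rule Bcontfun_inverse) (rule T, simp)
  have "\<exists>!\<psi>. TT \<psi> = \<psi>"
  proof (rule banach_fix_type[of "1/2"])
    show "\<forall>f g. dist (TT f) (TT g) \<le> 1/2 * dist f g"
    proof (intro allI dist_bound)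
      fix f g :: "real \<Rightarrow>\<^sub>C real" and x
      have "\<bar>f t - g t\<bar> \<le> dist f g" for t
        using dist_bounded[of f t g] by (simp add: dist_real_def)
      then show "dist (TT f x) (TT g x) \<le> 1/2 * dist f g"
        unfolding TT dist_real_def by (intro contr) auto
    qed
  qed auto
  then obtain \<psi> where "TT \<psi> = \<psi>" by blast
  then have \<psi>: "apply_bcontfun \<psi> x = T (apply_bcontfun \<psi>) x" for x
    using TT[of \<psi>] by simp
  define \<theta> where "\<theta> x = E x * apply_bcontfun \<psi> x" for x
  have eq: "\<theta> x = integral {0..x} (\<Phi> (apply_bcontfun \<psi>))" if "x \<in> {0..L}" for x
    unfolding \<theta>_def \<psi>[of x] T_def using c_id[OF that] E0[of x] by simp
  have "ac_on 0 L \<theta> (\<Phi> (apply_bcontfun \<psi>))"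
  proof (rule ac_onI)
    show "AI 0 L (\<Phi> (apply_bcontfun \<psi>))" by (rule \<Phi>) simp
    show "\<theta> x = \<theta> 0 + integral {0..x} (\<Phi> (apply_bcontfun \<psi>))" if "x \<in> {0..L}" for x
      using eq[OF that] eq[of 0] L by simp
  qed
  then have "angle_sol L B R \<theta>"
    unfolding angle_sol_def angle_ode_def \<Phi>_def \<theta>_def[symmetric] using eq[of 0] L by simp
  then show ?thesis by blast
qed

text \<open>Difference quotients of \<open>F\<close> and \<open>G\<close> become bounded measurable
  factors, so the difference of two solutions solves a linear equation. Uniqueness, comparison,
  strict monotonicity and stability all rest on it. The inhomogeneity contains the first solution
  only, which allows that solution to be the averaged angle later.\<close>

lemma angle_ode_diff:
  assumes B: "AI 0 L B1" "AI 0 L B2" and R: "AI 0 L R1" "AI 0 L R2"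
    and s: "angle_ode L B1 R1 \<theta>1" "angle_ode L B2 R2 \<theta>2"
  defines "h \<equiv> \<lambda>x. (B2 x - B1 x) * F (\<theta>1 x) + (R2 x - R1 x) * G (\<theta>1 x)"
  shows "\<exists>k. AI 0 L k \<and> (\<forall>x. \<bar>k x\<bar> \<le> C * (\<bar>B2 x\<bar> + \<bar>R2 x\<bar>)) \<and> AI 0 L h \<and>
    ac_on 0 L (\<lambda>x. \<theta>2 x - \<theta>1 x) (\<lambda>x. k x * (\<theta>2 x - \<theta>1 x) + h x)"
proof -
  have ac: "ac_on 0 L \<theta>1 (\<lambda>x. B1 x * F (\<theta>1 x) + R1 x * G (\<theta>1 x))"
    "ac_on 0 L \<theta>2 (\<lambda>x. B2 x * F (\<theta>2 x) + R2 x * G (\<theta>2 x))"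
    using s by (auto simp: angle_ode_def)
  note ct = ac_on_continuous[OF ac(1)] ac_on_continuous[OF ac(2)]
  \<comment> \<open>Where the two angles agree, the quotient is 0 / 0 = 0, which is what is needed.\<close>
  define Q where "Q H x = (H (\<theta>2 x) - H (\<theta>1 x)) / (\<theta>2 x - \<theta>1 x)" for H :: "real \<Rightarrow> real" and x
  have Qb: "\<bar>Q H x\<bar> \<le> C" if "\<And>x y. \<bar>H x - H y\<bar> \<le> C * \<bar>x - y\<bar>" for H x
    using that[of "\<theta>2 x" "\<theta>1 x"] C_nonneg unfolding Q_def by (cases "\<theta>2 x = \<theta>1 x") (auto simp: field_simps)
  have Qe: "Q H x * (\<theta>2 x - \<theta>1 x) = H (\<theta>2 x) - H (\<theta>1 x)" for H x
    by (simp add: Q_def)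
  have Qm: "Q H \<in> borel_measurable (lebesgue_on {0..L})" if H: "continuous_on UNIV H" for H
  proof -
    have "(\<lambda>x. H (\<theta>2 x) - H (\<theta>1 x)) \<in> borel_measurable (lebesgue_on {0..L})"
      by (rule continuous_imp_measurable_on_sets_lebesgue)
        (auto intro!: continuous_intros continuous_on_compose2[OF H] ct)
    moreover have "(\<lambda>x. \<theta>2 x - \<theta>1 x) \<in> borel_measurable (lebesgue_on {0..L})"
      by (rule continuous_imp_measurable_on_sets_lebesgue) (auto intro!: continuous_intros ct)
    ultimately show ?thesis unfolding Q_def by (rule borel_measurable_divide)
  qed
  define k where "k x = B2 x * Q F x + R2 x * Q G x" for x
  show ?thesis
  proof (intro exI[of _ k] conjI allI)
    show "AI 0 L k"
      unfolding k_def
      by (intro AI_add AI_mult_bounded[OF B(2) Qm[OF cont_F]] AI_mult_bounded[OF R(2) Qm[OF cont_G]])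
        (auto intro!: Qb F_lip G_lip)
    show "\<bar>k x\<bar> \<le> C * (\<bar>B2 x\<bar> + \<bar>R2 x\<bar>)" for x
    proof -
      have "\<bar>k x\<bar> \<le> \<bar>B2 x\<bar> * C + \<bar>R2 x\<bar> * C"
        unfolding k_def
        by (intro order_trans[OF abs_triangle_ineq] add_mono) (auto simp: abs_mult intro!: mult_left_mono Qb F_lip G_lip)
      then show ?thesis by (simp add: algebra_simps)
    qed
    show "AI 0 L h"
      unfolding h_def by (intro AI_field AI_diff B R ct)
    show "ac_on 0 L (\<lambda>x. \<theta>2 x - \<theta>1 x) (\<lambda>x. k x * (\<theta>2 x - \<theta>1 x) + h x)"
    proof (rule ac_on_cong[OF ac_on_diff[OF ac(2,1)]])
      fix x
      have "k x * (\<theta>2 x - \<theta>1 x) = B2 x * (F (\<theta>2 x) - F (\<theta>1 x)) + R2 x * (G (\<theta>2 x) - G (\<theta>1 x))"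
        unfolding k_def Qe[symmetric] by (simp add: algebra_simps)
      then show "k x * (\<theta>2 x - \<theta>1 x) + h x = B2 x * F (\<theta>2 x) + R2 x * G (\<theta>2 x) - (B1 x * F (\<theta>1 x) + R1 x * G (\<theta>1 x))"
        unfolding h_def by (simp add: algebra_simps)
    qed simp
  qed
qed

lemma angle_sol_unique:
  assumes "AI 0 L B" "AI 0 L R" "angle_sol L B R \<theta>1" "angle_sol L B R \<theta>2" "x \<in> {0..L}"
  shows "\<theta>2 x = \<theta>1 x"
proof -
  obtain k where k: "AI 0 L k" "\<And>x. \<bar>k x\<bar> \<le> C * (\<bar>B x\<bar> + \<bar>R x\<bar>)"
    "AI 0 L (\<lambda>x. (B x - B x) * F (\<theta>1 x) + (R x - R x) * G (\<theta>1 x))"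
    "ac_on 0 L (\<lambda>x. \<theta>2 x - \<theta>1 x) (\<lambda>x. k x * (\<theta>2 x - \<theta>1 x) + ((B x - B x) * F (\<theta>1 x) + (R x - R x) * G (\<theta>1 x)))"
    using angle_ode_diff[OF assms(1,1,2,2) assms(3,4)[THEN angle_sol_ode]] by blast
  have "\<theta>2 x - \<theta>1 x = 0"
    by (rule linear_ode_zero[OF _ k(1) _ assms(5)]) (use k(4) assms(3,4) in \<open>auto simp: angle_sol_def\<close>)
  then show ?thesis by simp
qed

text \<open>The two fields are compared only along the first solution. This suffices when the second
  one is a constant barrier.\<close>

lemma angle_ode_le:
  assumes B: "AI 0 L B1" "AI 0 L B2" and R: "AI 0 L R1" "AI 0 L R2"
    and s: "angle_ode L B1 R1 \<theta>1" "angle_ode L B2 R2 \<theta>2" "\<theta>1 0 \<le> \<theta>2 0"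
    and h: "\<And>x. x \<in> {0..L} \<Longrightarrow> 0 \<le> (B2 x - B1 x) * F (\<theta>1 x) + (R2 x - R1 x) * G (\<theta>1 x)"
    and x: "x \<in> {0..L}"
  shows "\<theta>1 x \<le> \<theta>2 x"
proof -
  obtain k where k: "AI 0 L k" "\<And>x. \<bar>k x\<bar> \<le> C * (\<bar>B2 x\<bar> + \<bar>R2 x\<bar>)"
    "AI 0 L (\<lambda>x. (B2 x - B1 x) * F (\<theta>1 x) + (R2 x - R1 x) * G (\<theta>1 x))"
    "ac_on 0 L (\<lambda>x. \<theta>2 x - \<theta>1 x) (\<lambda>x. k x * (\<theta>2 x - \<theta>1 x) + ((B2 x - B1 x) * F (\<theta>1 x) + (R2 x - R1 x) * G (\<theta>1 x)))"
    using angle_ode_diff[OF B R s(1,2)] by blast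
  have "0 \<le> \<theta>2 x - \<theta>1 x"
    by (rule linear_ode_nonneg[OF k(4,1,3) _ h x]) (use s(3) in auto)
  then show ?thesis by simp
qed

text \<open>The perturbation only has to be small after integration, so weak convergence of the
  coefficients suffices.\<close>

lemma angle_sol_perturbation:
  assumes B: "AI 0 L B1" "AI 0 L B2" and R: "AI 0 L R1" "AI 0 L R2"
    and s: "angle_sol L B1 R1 \<theta>1" "angle_sol L B2 R2 \<theta>2" 
    and K: "C * integral {0..L} (\<lambda>x. \<bar>B2 x\<bar> + \<bar>R2 x\<bar>) \<le> K"
    and \<eta>: "\<And>x. x \<in> {0..L} \<Longrightarrow> \<bar>integral {0..x} (\<lambda>t. (B2 t - B1 t) * F (\<theta>1 t) + (R2 t - R1 t) * G (\<theta>1 t))\<bar> \<le> \<eta>"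
    and x: "x \<in> {0..L}"
  shows "\<bar>\<theta>2 x - \<theta>1 x\<bar> \<le> \<eta> * (1 + exp (2 * K) * K)"
proof -
  define h where "h x = (B2 x - B1 x) * F (\<theta>1 x) + (R2 x - R1 x) * G (\<theta>1 x)" for x
  obtain k where k: "AI 0 L k" "\<And>x. \<bar>k x\<bar> \<le> C * (\<bar>B2 x\<bar> + \<bar>R2 x\<bar>)"
    "AI 0 L h" "ac_on 0 L (\<lambda>x. \<theta>2 x - \<theta>1 x) (\<lambda>x. k x * (\<theta>2 x - \<theta>1 x) + h x)"
    using angle_ode_diff[OF B R s[THEN angle_sol_ode]] unfolding h_def by blast
  \<comment> \<open>Subtracting the primitive of \<open>h\<close> replaces the inhomogeneity
    \<open>h\<close>, which may be large, by \<open>k x * e x\<close>, which is small in the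
    integral norm because \<open>e\<close> is uniformly small.\<close>
  define e where "e x = 0 + integral {0..x} h" for x
  have e: "ac_on 0 L e h" unfolding e_def by (rule ac_on_integral[OF k(3)])
  have e\<eta>: "\<bar>e x\<bar> \<le> \<eta>" if "x \<in> {0..L}" for x
    using \<eta>[OF that] by (simp add: e_def h_def[abs_def])
  have ke: "AI 0 L (\<lambda>x. k x * e x)"
    by (rule AI_mult_continuous[OF k(1) ac_on_continuous[OF e]])
  have "integral {0..L} (\<lambda>x. \<bar>k x\<bar>) \<le> integral {0..L} (\<lambda>x. C * (\<bar>B2 x\<bar> + \<bar>R2 x\<bar>))"
    by (intro integral_le AI_integrable AI_abs k AI_cmult AI_add B R)
  then have K': "integral {0..L} (\<lambda>x. \<bar>k x\<bar>) \<le> K" using K by simp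
  have "integral {0..L} (\<lambda>t. \<bar>k t * e t\<bar>) \<le> integral {0..L} (\<lambda>t. \<eta> * \<bar>k t\<bar>)"
    using e\<eta> by (intro integral_le AI_integrable AI_abs ke AI_cmult k)
      (simp add: abs_mult mult.commute mult_right_mono)
  also have "\<dots> \<le> \<eta> * K"
  proof -
    have "0 \<le> \<eta>" using e\<eta>[OF x] by linarith
    then show ?thesis using mult_left_mono[OF K', of \<eta>] by simp
  qed
  finally have "exp (2 * K) * integral {0..L} (\<lambda>t. \<bar>k t * e t\<bar>) \<le> exp (2 * K) * (\<eta> * K)"
    by simp
  moreover have "\<bar>(\<theta>2 x - \<theta>1 x) - e x\<bar> \<le> exp (2 * K) * integral {0..L} (\<lambda>t. \<bar>k t * e t\<bar>)"
  proof (rule linear_ode_bound[where k = k and d = "\<lambda>x. (\<theta>2 x - \<theta>1 x) - e x" and h = "\<lambda>x. k x * e x" and a = 0])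
    show "ac_on 0 L (\<lambda>x. (\<theta>2 x - \<theta>1 x) - e x) (\<lambda>x. k x * ((\<theta>2 x - \<theta>1 x) - e x) + k x * e x)"
      by (rule ac_on_cong[OF ac_on_diff[OF k(4) e]]) (auto simp: algebra_simps)
    show "\<theta>2 0 - \<theta>1 0 - e 0 = 0" using s by (simp add: angle_sol_def e_def)
  qed (use k ke K' x in auto)
  ultimately have "\<bar>(\<theta>2 x - \<theta>1 x) - e x\<bar> \<le> exp (2 * K) * (\<eta> * K)" by linarith
  then show ?thesis using e\<eta>[OF x] by (simp add: algebra_simps)
qed

end

section \<open>Conjugate powers and the angular coefficients\<close>


text \<open>The relation is equivalent to 1/p + 1/q = 1, in the form that says directly that the
  exponents p - 1 and q - 1 of \<open>phi p\<close> and \<open>phi q\<close> are reciprocal.\<close>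

locale conjugate_exponents =
  fixes p q :: real
  assumes p1: "1 < p" and pq: "(p - 1) * (q - 1) = 1"
begin

lemma q1: "1 < q"
  using p1 pq zero_less_mult_pos[of "p - 1" "q - 1"] by simp

text \<open>Every fact about p is thereby available for q; in the planar system this exchanges the
  roles of u and w.\<close>

lemma swap: "conjugate_exponents q p"
  using q1 pq by unfold_locales (simp_all add: mult.commute)

lemma q_mult: "q * (p - 1) = p" and p_mult: "p * (q - 1) = q"
  using pq by (auto simp: algebra_simps)

end

section \<open>The odd power maps \<open>phi p\<close> and \<open>phi q\<close>\<close>

lemma phi_0 [simp]: "phi p 0 = 0"
  by (simp add: phi_def)

lemma phi_minus [simp]: "phi p (- s) = - phi p s"
  by (simp add: phi_def)

lemma phi_eq_0_iff [simp]: "phi p s = 0 \<longleftrightarrow> s = 0"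
  by (simp add: phi_def)

lemma phi_mult: "phi p (c * s) = phi p c * phi p s"
  by (simp add: phi_def abs_mult powr_mult)

lemma phi_pos: "0 < s \<Longrightarrow> phi p s = s powr (p - 1)"
  using powr_add[of s "p - 2" 1] by (simp add: phi_def)

lemma phi_nonneg: "0 \<le> s \<Longrightarrow> phi p s = s powr (p - 1)"
  by (cases "s = 0") (auto simp: phi_pos)

lemma abs_phi: "\<bar>phi p s\<bar> = \<bar>s\<bar> powr (p - 1)"
proof -
  have "\<bar>phi p s\<bar> = phi p \<bar>s\<bar>" by (simp add: phi_def abs_mult)
  then show ?thesis by (simp add: phi_nonneg)
qed

lemma phi_mult_self: "phi p s * s = \<bar>s\<bar> powr p"
proof -
  have "\<bar>s\<bar> powr p = \<bar>s\<bar> powr (p - 2) * \<bar>s\<bar>\<^sup>2" if "s \<noteq> 0"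
    using powr_add[of "\<bar>s\<bar>" "p - 2" 2] that by (simp add: powr_numeral)
  then show ?thesis by (cases "s = 0") (auto simp: phi_def power2_eq_square)
qed

lemma phi_exp: "phi p (exp k) = exp ((p - 1) * k)"
  by (simp add: phi_pos powr_def)

context conjugate_exponents
begin

lemma phi_phi: "phi p (phi q s) = s"
proof -
  have pos: "phi p (phi q s) = s" if "0 < s" for s
    using that pq by (simp add: phi_pos powr_powr mult.commute)
  show ?thesis
    using pos[of s] pos[of "- s"] by (cases s "0::real" rule: linorder_cases) auto
qed

lemma cont_phi: "continuous_on S (phi p)"
proof -
  \<comment> \<open>For p < 2 the factor \<open>\<bar>s\<bar> powr (p - 2)\<close> is unbounded near
    0. Powers with the positive exponent p - 1 show the continuity there.\<close>
  have "phi p s = max s 0 powr (p - 1) - max (- s) 0 powr (p - 1)" for s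
    using phi_nonneg[of s p] phi_nonneg[of "- s" p] by (cases "0 \<le> s") (auto simp: max_def)
  moreover have "continuous_on S (\<lambda>s. max s 0 powr (p - 1) - max (- s) 0 powr (p - 1))"
    using p1 by (intro continuous_intros continuous_on_powr') auto
  ultimately show ?thesis by simp
qed

lemma cont_phi_compose: "continuous_on S f \<Longrightarrow> continuous_on S (\<lambda>x. phi p (f x))"
  by (rule continuous_on_compose2[OF cont_phi[of UNIV]]) auto

lemma DERIV_abs_powr: "((\<lambda>s. \<bar>s\<bar> powr p) has_real_derivative p * phi p s) (at s)"
proof -
  have pos: "((\<lambda>s. \<bar>s\<bar> powr p) has_real_derivative p * phi p s) (at s)" if "0 < s" for s
  proof (rule has_field_derivative_transform_within_open)
    show "((\<lambda>s. s powr p) has_real_derivative p * phi p s) (at s)"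
      using that has_real_derivative_powr[of s p] by (simp add: phi_pos)
    show "open {0::real<..}" "s \<in> {0<..}" "\<And>x. x \<in> {0<..} \<Longrightarrow> x powr p = \<bar>x\<bar> powr p"
      using that by (auto intro: open_greaterThan)
  qed
  consider "0 < s" | "s < 0" | "s = 0" by linarith
  then show ?thesis
  proof cases
    case 2
    then have "((\<lambda>s. \<bar>s\<bar> powr p) has_real_derivative p * phi p (- s)) (at (- s))" by (intro pos) auto
    then have "((\<lambda>s. \<bar>- s\<bar> powr p) has_real_derivative p * phi p (- s) * (-1)) (at s)"
      by (intro DERIV_chain2[where f = "\<lambda>s. \<bar>s\<bar> powr p" and g = uminus]) (auto intro!: derivative_eq_intros)
    then show ?thesis by simp
  next
    case 3
    have "continuous (at 0) (phi p)"
      using cont_phi[of UNIV] by (simp add: continuous_on_eq_continuous_at)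
    then have "(phi p \<longlongrightarrow> 0) (at 0)" by (simp add: continuous_at)
    \<comment> \<open>At 0 the difference quotient is \<open>phi p\<close> itself, also at h = 0,
      where 0 / 0 = 0. Continuity of \<open>phi p\<close> thus gives the derivative.\<close>
    moreover have "phi p = (\<lambda>h. (\<bar>0 + h\<bar> powr p - \<bar>0\<bar> powr p) / h)"
    proof
      show "phi p h = (\<bar>0 + h\<bar> powr p - \<bar>0\<bar> powr p) / h" for h
        using phi_mult_self[of p h] p1 by (cases "h = 0") (auto simp: field_simps)
    qed
    ultimately have "((\<lambda>h. (\<bar>0 + h\<bar> powr p - \<bar>0\<bar> powr p) / h) \<longlongrightarrow> 0) (at 0)" by simp
    then show ?thesis using 3 by (simp add: DERIV_def)
  qed (rule pos)
qed

lemma DERIV_phi: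
  assumes "s \<noteq> 0"
  shows "(phi p has_real_derivative (p - 1) * \<bar>s\<bar> powr (p - 2)) (at s)"
proof -
  have pos: "(phi p has_real_derivative (p - 1) * \<bar>s\<bar> powr (p - 2)) (at s)" if "0 < s" for s
  proof (rule has_field_derivative_transform_within_open)
    show "((\<lambda>s. s powr (p - 1)) has_real_derivative (p - 1) * \<bar>s\<bar> powr (p - 2)) (at s)"
      using that has_real_derivative_powr[of s "p - 1"] by simp
    show "open {0::real<..}" "s \<in> {0<..}" "\<And>x. x \<in> {0<..} \<Longrightarrow> x powr (p - 1) = phi p x"
      using that by (auto simp: phi_pos intro: open_greaterThan)
  qed
  show ?thesis
  proof (cases "0 < s")
    case False
    then have "(phi p has_real_derivative (p - 1) * \<bar>- s\<bar> powr (p - 2)) (at (- s))"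
      using assms by (intro pos) auto
    then have "((\<lambda>s. phi p (- s)) has_real_derivative (p - 1) * \<bar>- s\<bar> powr (p - 2) * (-1)) (at s)"
      by (intro DERIV_chain2[where f = "phi p" and g = uminus]) (auto intro!: derivative_eq_intros)
    from DERIV_minus[OF this] show ?thesis by simp
  qed (rule pos)
qed

text \<open>With \<open>m\<close> the larger of the two terms on the right, the factors are at most
  \<open>m\<close> to the powers 1/q and 1/p, and these exponents add up to 1. The bound makes the
  rate of change of the energy in \<open>sys_zero\<close> proportional to the energy.\<close>

lemma Young_phi: "\<bar>phi p u * phi q w\<bar> \<le> \<bar>u\<bar> powr p + \<bar>w\<bar> powr q"
proof -
  define m where "m = max (\<bar>u\<bar> powr p) (\<bar>w\<bar> powr q)"
  have m: "0 \<le> m" by (simp add: m_def le_max_iff_disj)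
  have e: "p * (1 / q) = p - 1" "q * (1 / p) = q - 1"
    using q_mult p_mult q1 p1 by (simp_all add: field_simps)
  have "\<bar>u\<bar> powr (p - 1) = (\<bar>u\<bar> powr p) powr (1 / q)"
    by (simp only: powr_powr e)
  also have "\<dots> \<le> m powr (1 / q)" using q1 by (intro powr_mono2) (auto simp: m_def)
  finally have 1: "\<bar>phi p u\<bar> \<le> m powr (1 / q)" by (simp add: abs_phi)
  have "\<bar>w\<bar> powr (q - 1) = (\<bar>w\<bar> powr q) powr (1 / p)"
    by (simp only: powr_powr e)
  also have "\<dots> \<le> m powr (1 / p)" using p1 by (intro powr_mono2) (auto simp: m_def)
  finally have 2: "\<bar>phi q w\<bar> \<le> m powr (1 / p)" by (simp add: abs_phi)
  have "1 / q + 1 / p = 1" using p1 q1 pq by (simp add: field_simps)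
  then have "m powr (1 / q) * m powr (1 / p) = m" using m by (simp flip: powr_add)
  then have "\<bar>phi p u * phi q w\<bar> \<le> m"
    using mult_mono[OF 1 2] by (simp add: abs_mult)
  also have "m \<le> \<bar>u\<bar> powr p + \<bar>w\<bar> powr q" by (simp add: m_def)
  finally show ?thesis .
qed

text \<open>Inserting u = e^k sin t, w = e^((p-1)k) cos t into u' = B phi_q(w), w' = - R phi_p(u)
  and cancelling exponentials gives two linear equations for k' and t'. Their determinant is
  \<open>den\<close> up to sign, and solving for t' gives B F(t) + R G(t).\<close>

definition den :: "real \<Rightarrow> real" where "den x = (p - 1) * (cos x)\<^sup>2 + (sin x)\<^sup>2"
definition F :: "real \<Rightarrow> real" where "F x = (p - 1) * \<bar>cos x\<bar> powr q / den x"
definition G :: "real \<Rightarrow> real" where "G x = \<bar>sin x\<bar> powr p / den x"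

lemma den_pos: "0 < den x"
proof (cases "sin x = 0")
  case True
  then have "cos x \<noteq> 0" using sin_cos_squared_add[of x] by auto
  then show ?thesis using p1 True by (simp add: den_def)
next
  case False
  then show ?thesis using p1 by (auto simp: den_def intro!: add_nonneg_pos)
qed

text \<open>Periodicity is stated as dependence on sine and cosine alone, which can be read off the
  definitions of the functions concerned.\<close>

lemma periodic_bounded:
  fixes f :: "real \<Rightarrow> real"
  assumes "continuous_on UNIV f" "\<And>x y. sin x = sin y \<Longrightarrow> cos x = cos y \<Longrightarrow> f x = f y"
  shows "\<exists>C. \<forall>x. \<bar>f x\<bar> \<le> C"
proof -
  have "bounded (f ` {0..2 * pi})"
    using assms(1) by (intro compact_imp_bounded compact_continuous_image) (auto intro: continuous_on_subset)
  then obtain C where C: "\<And>x. x \<in> {0..2 * pi} \<Longrightarrow> \<bar>f x\<bar> \<le> C"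
    unfolding bounded_iff by (metis imageI real_norm_def)
  have "\<bar>f x\<bar> \<le> C" for x
  proof -
    obtain t where "0 \<le> t" "t < 2 * pi" "cos x = cos t" "sin x = sin t"
      using sincos_total_2pi[of "cos x" "sin x"] by auto
    then show ?thesis using assms(2)[of x t] C[of t] by auto
  qed
  then show ?thesis by blast
qed

lemma periodic_Lipschitz:
  fixes f :: "real \<Rightarrow> real"
  assumes "\<And>x. (f has_real_derivative f' x) (at x)"
    "continuous_on UNIV f'" "\<And>x y. sin x = sin y \<Longrightarrow> cos x = cos y \<Longrightarrow> f' x = f' y"
  shows "\<exists>C. \<forall>x y. \<bar>f x - f y\<bar> \<le> C * \<bar>x - y\<bar>"
proof -
  obtain C where "\<bar>f' x\<bar> \<le> C" for x using periodic_bounded[OF assms(2,3)] by auto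
  then have "\<bar>f x - f y\<bar> \<le> C * \<bar>x - y\<bar>" for x y
    using field_differentiable_bound[of UNIV f f' C x y] assms(1) by auto
  then show ?thesis by blast
qed

text \<open>Quotient rule, with \<open>2 * (2 - p) * sin x * cos x\<close> the derivative of
  \<open>den\<close>. Written through \<open>phi\<close>, the expression is visibly continuous at
  the zeros of the cosine, although q may be less than 2; likewise \<open>G'\<close> at the zeros of
  the sine.\<close>

definition F' :: "real \<Rightarrow> real" where
  "F' x = (p - 1) * ((q * phi q (cos x) * - sin x) * den x - \<bar>cos x\<bar> powr q * (2 * (2 - p) * sin x * cos x)) / (den x)\<^sup>2"
definition G' :: "real \<Rightarrow> real" where
  "G' x = ((p * phi p (sin x) * cos x) * den x - \<bar>sin x\<bar> powr p * (2 * (2 - p) * sin x * cos x)) / (den x)\<^sup>2"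

lemma DERIV_den: "(den has_real_derivative 2 * (2 - p) * sin x * cos x) (at x)"
  unfolding den_def by (auto intro!: derivative_eq_intros simp: algebra_simps)

lemma DERIV_F: "(F has_real_derivative F' x) (at x)"
proof -
  have "((\<lambda>x. \<bar>cos x\<bar> powr q) has_real_derivative q * phi q (cos x) * - sin x) (at x)"
    by (rule DERIV_chain2[OF conjugate_exponents.DERIV_abs_powr[OF swap]]) (rule DERIV_cos)
  from DERIV_cmult[OF DERIV_divide[OF this DERIV_den], of "p - 1"] den_pos[of x]
  show ?thesis unfolding F_def F'_def by (simp add: power2_eq_square)
qed

lemma DERIV_G: "(G has_real_derivative G' x) (at x)"
proof -
  have "((\<lambda>x. \<bar>sin x\<bar> powr p) has_real_derivative p * phi p (sin x) * cos x) (at x)"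
    by (rule DERIV_chain2[OF DERIV_abs_powr]) (rule DERIV_sin)
  from DERIV_divide[OF this DERIV_den] den_pos[of x]
  show ?thesis unfolding G_def G'_def by (simp add: power2_eq_square)
qed

lemma cont_den: "continuous_on S den"
  unfolding den_def by (intro continuous_intros)

lemma cont_F': "continuous_on S F'" and cont_G': "continuous_on S G'"
  unfolding F'_def G'_def using den_pos p1 q1
  by (auto intro!: continuous_intros cont_den cont_phi_compose conjugate_exponents.cont_phi_compose[OF swap]
      continuous_on_powr' simp: less_imp_neq[THEN not_sym])

lemma contF: "continuous_on S F" and contG: "continuous_on S G"
  by (auto intro!: DERIV_continuous_on DERIV_F[THEN has_field_derivative_at_within] DERIV_G[THEN has_field_derivative_at_within])

lemma ex_bound: "\<exists>C. \<forall>x y. \<bar>F x - F y\<bar> \<le> C * \<bar>x - y\<bar> \<and> \<bar>G x - G y\<bar> \<le> C * \<bar>x - y\<bar> \<and> \<bar>F x\<bar> \<le> C \<and> \<bar>G x\<bar> \<le> C"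
proof -
  obtain C1 where 1: "\<And>x y. \<bar>F x - F y\<bar> \<le> C1 * \<bar>x - y\<bar>"
    using periodic_Lipschitz[OF DERIV_F cont_F'] by (auto simp: F'_def den_def)
  obtain C2 where 2: "\<And>x y. \<bar>G x - G y\<bar> \<le> C2 * \<bar>x - y\<bar>"
    using periodic_Lipschitz[OF DERIV_G cont_G'] by (auto simp: G'_def den_def)
  obtain C3 where 3: "\<And>x. \<bar>F x\<bar> \<le> C3" using periodic_bounded[OF contF] by (auto simp: F_def den_def)
  obtain C4 where 4: "\<And>x. \<bar>G x\<bar> \<le> C4" using periodic_bounded[OF contG] by (auto simp: G_def den_def)
  define C where "C = \<bar>C1\<bar> + \<bar>C2\<bar> + \<bar>C3\<bar> + \<bar>C4\<bar>"
  have "C1 \<le> C" "C2 \<le> C" "C3 \<le> C" "C4 \<le> C" by (auto simp: C_def)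
  then have "\<bar>F x - F y\<bar> \<le> C * \<bar>x - y\<bar> \<and> \<bar>G x - G y\<bar> \<le> C * \<bar>x - y\<bar> \<and> \<bar>F x\<bar> \<le> C \<and> \<bar>G x\<bar> \<le> C" for x y
    using order_trans[OF 1[of x y] mult_right_mono[of C1 C "\<bar>x - y\<bar>"]]
      order_trans[OF 2[of x y] mult_right_mono[of C2 C "\<bar>x - y\<bar>"]] order_trans[OF 3[of x]] order_trans[OF 4[of x]]
    by simp
  then show ?thesis by blast
qed

definition C :: real where
  "C = (SOME C. \<forall>x y. \<bar>F x - F y\<bar> \<le> C * \<bar>x - y\<bar> \<and> \<bar>G x - G y\<bar> \<le> C * \<bar>x - y\<bar> \<and> \<bar>F x\<bar> \<le> C \<and> \<bar>G x\<bar> \<le> C)"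

sublocale angle_field F G C
  using someI_ex[OF ex_bound] unfolding C_def[symmetric] by unfold_locales blast+

lemma F_nonneg: "0 \<le> F x" and G_nonneg: "0 \<le> G x"
  using p1 den_pos[of x] by (auto simp: F_def G_def)

end

section \<open>The planar system\<close>


lemma integral_pos_AE:
  assumes f: "AI a b f" and "a < b" and nn: "\<And>x. x \<in> {a..b} \<Longrightarrow> 0 \<le> f x"
    and pos: "AE x in lebesgue. x \<in> {a..b} \<longrightarrow> 0 < f x"
  shows "0 < integral {a..b} f"
proof -
  have eq: "integral {a..b} f = (LINT x:{a..b}|lebesgue. f x)"
    by (rule set_lebesgue_integral_eq_integral(2)[OF f, symmetric])
  have i: "integrable lebesgue (\<lambda>x. indicator {a..b} x *\<^sub>R f x)"
    using f by (simp add: set_integrable_def)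
  have ne: "(LINT x:{a..b}|lebesgue. f x) \<noteq> 0"
  proof
    assume "(LINT x:{a..b}|lebesgue. f x) = 0"
    then have "AE x in lebesgue. indicator {a..b} x *\<^sub>R f x = 0"
      using integral_nonneg_eq_0_iff_AE[OF i] nn unfolding set_lebesgue_integral_def
      by (auto simp: indicator_def)
    with pos have "AE x in lebesgue. x \<notin> {a..b}"
      by eventually_elim (auto simp: indicator_def)
    then have "{a..b} \<in> null_sets lebesgue"
      by (subst AE_iff_null_sets) auto
    then show False using \<open>a < b\<close> by (auto simp: null_sets_def)
  qed
  have "0 \<le> integral {a..b} f" by (rule integral_nonneg[OF AI_integrable[OF f] nn])
  then show ?thesis using ne eq by linarith
qed

lemma continuous_on_nonzero_near:
  fixes f :: "real \<Rightarrow> real"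
  assumes "continuous_on {a..b} f" "x \<in> {a..b}" "f x \<noteq> 0"
  shows "\<exists>\<delta>>0. \<forall>t\<in>{a..b}. \<bar>t - x\<bar> < \<delta> \<longrightarrow> f t \<noteq> 0"
proof -
  have "0 < \<bar>f x\<bar>" using assms(3) by simp
  then obtain \<delta> where "\<delta> > 0" "\<forall>t\<in>{a..b}. \<bar>t - x\<bar> < \<delta> \<longrightarrow> \<bar>f t - f x\<bar> < \<bar>f x\<bar>"
    using assms(1,2) unfolding continuous_on_iff dist_real_def by blast
  then show ?thesis by (intro exI[of _ \<delta>]) auto
qed

context conjugate_exponents
begin

definition sys :: "real \<Rightarrow> real \<Rightarrow> (real \<Rightarrow> real) \<Rightarrow> (real \<Rightarrow> real) \<Rightarrow> (real \<Rightarrow> real) \<Rightarrow> (real \<Rightarrow> real) \<Rightarrow> bool" where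
  "sys a b B R u w \<longleftrightarrow>
     ac_on a b u (\<lambda>x. B x * phi q (w x)) \<and> ac_on a b w (\<lambda>x. - (R x * phi p (u x)))"

lemma sys_scale:
  assumes "sys a b B R u w"
  shows "sys a b B R (\<lambda>x. c * u x) (\<lambda>x. phi p c * w x)"
proof -
  have "phi q (phi p c) = c"
    by (rule conjugate_exponents.phi_phi[OF swap])
  then show ?thesis
    using ac_on_cmult[of a b u "\<lambda>x. B x * phi q (w x)" c] ac_on_cmult[of a b w "\<lambda>x. - (R x * phi p (u x))" "phi p c"] assms
    by (simp add: sys_def phi_mult mult.left_commute)
qed

text \<open>The unit circle meets every orbit of the quasi-homogeneous scaling once and transversally, so
  the ordinary sine and cosine can replace the generalized ones.\<close>

lemma sys_of_angle:
  assumes B: "AI 0 L B" and R: "AI 0 L R" and s: "angle_sol L B R \<theta>"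
  obtains k where "sys 0 L B R (\<lambda>x. exp (k x) * sin (\<theta> x)) (\<lambda>x. exp ((p - 1) * k x) * cos (\<theta> x))" "k 0 = 0"
proof -
  have \<theta>: "ac_on 0 L \<theta> (\<lambda>x. B x * F (\<theta> x) + R x * G (\<theta> x))" by (rule angle_sol_ac[OF s])
  note c = ac_on_continuous[OF \<theta>]
  have dn: "den x \<noteq> 0" for x using den_pos[of x] by simp
  \<comment> \<open>The logarithmic radius grows at this rate: it is the other unknown of the linear
    equations that define \<open>F\<close> and \<open>G\<close>, obtained by eliminating the
    derivative of the angle.\<close>
  define k' where "k' x = B x * (phi q (cos (\<theta> x)) * sin (\<theta> x) / den (\<theta> x)) - R x * (phi p (sin (\<theta> x)) * cos (\<theta> x) / den (\<theta> x))" for x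
  have "AI 0 L k'"
    unfolding k'_def
    by (intro AI_diff AI_mult_continuous B R continuous_intros cont_phi_compose conjugate_exponents.cont_phi_compose[OF swap]
        continuous_on_compose2[OF cont_den[of UNIV]] c) (auto simp: dn)
  then have k: "ac_on 0 L (\<lambda>x. 0 + integral {0..x} k') k'" by (rule ac_on_integral)
  define k where "k x = 0 + integral {0..x} k'" for x
  have k: "ac_on 0 L k k'" using k unfolding k_def .
  have ex: "ac_on 0 L (\<lambda>x. exp (m * k x)) (\<lambda>x. exp (m * k x) * (m * k' x))" for m
    by (rule ac_on_chain[OF ac_on_cmult[OF k]])
      (auto intro!: derivative_eq_intros continuous_intros ac_on_continuous[OF k])
  have sn: "ac_on 0 L (\<lambda>x. sin (\<theta> x)) (\<lambda>x. cos (\<theta> x) * (B x * F (\<theta> x) + R x * G (\<theta> x)))"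
    by (rule ac_on_chain[OF \<theta>]) (auto intro!: derivative_eq_intros continuous_intros c)
  have cs: "ac_on 0 L (\<lambda>x. cos (\<theta> x)) (\<lambda>x. - sin (\<theta> x) * (B x * F (\<theta> x) + R x * G (\<theta> x)))"
    by (rule ac_on_chain[OF \<theta>]) (auto intro!: derivative_eq_intros continuous_intros c)
  have 1: "k' x * sin (\<theta> x) + cos (\<theta> x) * (B x * F (\<theta> x) + R x * G (\<theta> x)) = B x * phi q (cos (\<theta> x))"
    and 2: "(p - 1) * k' x * cos (\<theta> x) - sin (\<theta> x) * (B x * F (\<theta> x) + R x * G (\<theta> x)) = - (R x * phi p (sin (\<theta> x)))" for x
  proof -
    define S K D P Q where "S = sin (\<theta> x)" "K = cos (\<theta> x)" "D = den (\<theta> x)" "P = phi p (sin (\<theta> x))" "Q = phi q (cos (\<theta> x))"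
    have D: "D \<noteq> 0" "D = (p - 1) * K\<^sup>2 + S\<^sup>2" using dn by (auto simp: S_K_D_P_Q_def den_def)
    have F: "F (\<theta> x) = (p - 1) * (Q * K) / D" and G: "G (\<theta> x) = P * S / D"
      by (auto simp: F_def G_def S_K_D_P_Q_def phi_mult_self)
    have k': "k' x = B x * (Q * S / D) - R x * (P * K / D)"
      by (simp add: k'_def S_K_D_P_Q_def)
    have "k' x * S + K * (B x * F (\<theta> x) + R x * G (\<theta> x)) = B x * Q * ((p - 1) * K\<^sup>2 + S\<^sup>2) / D"
      unfolding F G k' using D(1) by (simp add: field_simps power2_eq_square)
    then show "k' x * sin (\<theta> x) + cos (\<theta> x) * (B x * F (\<theta> x) + R x * G (\<theta> x)) = B x * phi q (cos (\<theta> x))"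
      unfolding D(2)[symmetric] using D(1) by (simp add: S_K_D_P_Q_def)
    have "(p - 1) * k' x * K - S * (B x * F (\<theta> x) + R x * G (\<theta> x)) = - (R x * P * ((p - 1) * K\<^sup>2 + S\<^sup>2) / D)"
      unfolding F G k' using D(1) by (simp add: field_simps power2_eq_square)
    then show "(p - 1) * k' x * cos (\<theta> x) - sin (\<theta> x) * (B x * F (\<theta> x) + R x * G (\<theta> x)) = - (R x * phi p (sin (\<theta> x)))"
      unfolding D(2)[symmetric] using D(1) by (simp add: S_K_D_P_Q_def)
  qed
  show thesis
  proof
    have u: "ac_on 0 L (\<lambda>x. exp (1 * k x) * sin (\<theta> x)) (\<lambda>x. B x * phi q (exp ((p - 1) * k x) * cos (\<theta> x)))"
    proof (rule ac_on_cong[OF ac_on_mult[OF ex sn]])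
      fix x
      have "phi q (exp ((p - 1) * k x) * cos (\<theta> x)) = exp (k x) * phi q (cos (\<theta> x))"
        using pq by (simp add: phi_mult phi_exp mult.assoc[symmetric] mult.commute[of "q - 1"])
      then show "B x * phi q (exp ((p - 1) * k x) * cos (\<theta> x)) =
         exp (1 * k x) * (1 * k' x) * sin (\<theta> x) + exp (1 * k x) * (cos (\<theta> x) * (B x * F (\<theta> x) + R x * G (\<theta> x)))"
        using arg_cong[OF 1[of x], of "\<lambda>y. exp (k x) * y"] by (simp add: algebra_simps)
    qed simp
    have w: "ac_on 0 L (\<lambda>x. exp ((p - 1) * k x) * cos (\<theta> x)) (\<lambda>x. - (R x * phi p (exp (k x) * sin (\<theta> x))))"
    proof (rule ac_on_cong[OF ac_on_mult[OF ex cs]])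
      fix x
      show "- (R x * phi p (exp (k x) * sin (\<theta> x))) =
         exp ((p - 1) * k x) * ((p - 1) * k' x) * cos (\<theta> x) + exp ((p - 1) * k x) * (- sin (\<theta> x) * (B x * F (\<theta> x) + R x * G (\<theta> x)))"
        using arg_cong[OF 2[of x], of "\<lambda>y. exp ((p - 1) * k x) * y"] by (simp add: phi_mult phi_exp algebra_simps)
    qed simp
    show "sys 0 L B R (\<lambda>x. exp (k x) * sin (\<theta> x)) (\<lambda>x. exp ((p - 1) * k x) * cos (\<theta> x))"
      using u w by (simp add: sys_def)
    show "k 0 = 0" by (simp add: k_def)
  qed
qed

text \<open>The ratio z = u / phi q w solves z' = B + (q - 1) R |z|^p, which is locally Lipschitz in z
  although the system is not Lipschitz in (u, w).\<close>

lemma sys_unique_chart: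
  assumes B: "AI a b B" and R: "AI a b R"
    and s1: "sys a b B R u1 w1" and s2: "sys a b B R u2 w2"
    and eq: "u1 a = u2 a" "w1 a = w2 a"
    and nz: "\<And>x. x \<in> {a..b} \<Longrightarrow> w1 x \<noteq> 0" "\<And>x. x \<in> {a..b} \<Longrightarrow> w2 x \<noteq> 0"
    and x: "x \<in> {a..b}"
  shows "u1 x = u2 x \<and> w1 x = w2 x"
proof -
  interpret qp: conjugate_exponents q p by (rule swap)
  have ratio: "ac_on a b (\<lambda>x. u x * inverse (phi q (w x))) (\<lambda>x. B x + (q - 1) * R x * \<bar>u x * inverse (phi q (w x))\<bar> powr p)"
    if s: "sys a b B R u w" and nz: "\<And>x. x \<in> {a..b} \<Longrightarrow> w x \<noteq> 0" for u w
  proof -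
    have u: "ac_on a b u (\<lambda>x. B x * phi q (w x))" and w: "ac_on a b w (\<lambda>x. - (R x * phi p (u x)))"
      using s by (auto simp: sys_def)
    have i: "ac_on a b (\<lambda>x. inverse (phi q (w x)))
      (\<lambda>x. - (inverse (phi q (w x)) * ((q - 1) * \<bar>w x\<bar> powr (q - 2)) * inverse (phi q (w x))) * - (R x * phi p (u x)))"
    proof (rule ac_on_chain[OF w])
      fix x assume x: "x \<in> {a..b}"
      show "((\<lambda>s. inverse (phi q s)) has_real_derivative
         - (inverse (phi q (w x)) * ((q - 1) * \<bar>w x\<bar> powr (q - 2)) * inverse (phi q (w x)))) (at (w x))"
        by (rule DERIV_inverse'[OF qp.DERIV_phi]) (use nz[OF x] in auto)
    next
      show "continuous_on {a..b} (\<lambda>x. - (inverse (phi q (w x)) * ((q - 1) * \<bar>w x\<bar> powr (q - 2)) * inverse (phi q (w x))))"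
        using nz by (intro continuous_intros qp.cont_phi_compose ac_on_continuous[OF w]) auto
    qed
    show ?thesis
    proof (rule ac_on_cong[OF ac_on_mult[OF u i]])
      fix x assume "x \<in> {a..b}"
      then have w0: "w x \<noteq> 0" by (rule nz)
      \<comment> \<open>Because (q - 1) p = q, the power is |u|^p / |w|^q, the same expression that
        differentiating 1 / phi_q(w) produces.\<close>
      have e: "\<bar>u x * inverse (phi q (w x))\<bar> powr p = phi p (u x) * u x * inverse (\<bar>w x\<bar> powr q)"
      proof -
        have "\<bar>u x * inverse (phi q (w x))\<bar> powr p = \<bar>u x\<bar> powr p * inverse (\<bar>w x\<bar> powr ((q - 1) * p))"
          by (simp add: abs_mult powr_mult abs_phi powr_powr inverse_powr[symmetric] powr_minus)
        then show ?thesis using p_mult by (simp add: phi_mult_self mult.commute[of "q - 1"])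
      qed
      have "inverse (phi q (w x)) * \<bar>w x\<bar> powr (q - 2) * inverse (phi q (w x)) = inverse (phi q (w x) * w x)"
        using w0 by (simp add: phi_def field_simps)
      then have f: "inverse (phi q (w x)) * \<bar>w x\<bar> powr (q - 2) * inverse (phi q (w x)) = inverse (\<bar>w x\<bar> powr q)"
        by (simp add: phi_mult_self)
      have h1: "B x * phi q (w x) * inverse (phi q (w x)) = B x" using w0 by simp
      have h2: "u x * (- (inverse (phi q (w x)) * ((q - 1) * \<bar>w x\<bar> powr (q - 2)) * inverse (phi q (w x))) * - (R x * phi p (u x)))
        = (q - 1) * R x * (phi p (u x) * u x * (inverse (phi q (w x)) * \<bar>w x\<bar> powr (q - 2) * inverse (phi q (w x))))"
        by (simp add: mult_ac)
      show "B x + (q - 1) * R x * \<bar>u x * inverse (phi q (w x))\<bar> powr p =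
        B x * phi q (w x) * inverse (phi q (w x)) +
        u x * (- (inverse (phi q (w x)) * ((q - 1) * \<bar>w x\<bar> powr (q - 2)) * inverse (phi q (w x))) * - (R x * phi p (u x)))"
        unfolding e h1 h2 f ..
    qed simp
  qed
  define z1 where "z1 x = u1 x * inverse (phi q (w1 x))" for x
  define z2 where "z2 x = u2 x * inverse (phi q (w2 x))" for x
  have z1: "ac_on a b z1 (\<lambda>x. B x + (q - 1) * R x * \<bar>z1 x\<bar> powr p)"
    unfolding z1_def by (rule ratio[OF s1 nz(1)])
  have z2: "ac_on a b z2 (\<lambda>x. B x + (q - 1) * R x * \<bar>z2 x\<bar> powr p)"
    unfolding z2_def by (rule ratio[OF s2 nz(2)])
  note c1 = ac_on_continuous[OF z1] and c2 = ac_on_continuous[OF z2]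
  obtain M1 where M1: "\<And>x. x \<in> {a..b} \<Longrightarrow> \<bar>z1 x\<bar> \<le> M1"
    using compact_imp_bounded[OF compact_continuous_image[OF c1 compact_Icc]] unfolding bounded_iff by (metis imageI real_norm_def)
  obtain M2 where M2: "\<And>x. x \<in> {a..b} \<Longrightarrow> \<bar>z2 x\<bar> \<le> M2"
    using compact_imp_bounded[OF compact_continuous_image[OF c2 compact_Icc]] unfolding bounded_iff by (metis imageI real_norm_def)
  define M where "M = max M1 M2"
  \<comment> \<open>On [-M, M] the function |z|^p has slope at most p M^(p-1), so its difference
    quotient is a bounded factor and the difference of the ratios solves a homogeneous linear
    equation.\<close>
  define Q where "Q x = (\<bar>z1 x\<bar> powr p - \<bar>z2 x\<bar> powr p) / (z1 x - z2 x)" for x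
  have Qb: "\<bar>Q x\<bar> \<le> p * M powr (p - 1)" if x: "x \<in> {a..b}" for x
  proof -
    have M0: "\<bar>z1 x\<bar> \<le> M" "\<bar>z2 x\<bar> \<le> M" using M1[OF x] M2[OF x] by (auto simp: M_def)
    have "norm (\<bar>z1 x\<bar> powr p - \<bar>z2 x\<bar> powr p) \<le> p * M powr (p - 1) * norm (z1 x - z2 x)"
    proof (rule field_differentiable_bound[of "{-M..M}"])
      show "((\<lambda>s. \<bar>s\<bar> powr p) has_field_derivative p * phi p z) (at z within {-M..M})" for z
        by (rule has_field_derivative_at_within[OF DERIV_abs_powr])
      fix z assume "z \<in> {-M..M}"
      then show "norm (p * phi p z) \<le> p * M powr (p - 1)"
        using p1 by (auto simp: abs_mult abs_phi intro!: powr_mono2)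
    qed (use M0 in auto)
    then show ?thesis unfolding Q_def using M0 p1
      by (cases "z1 x = z2 x") (auto simp: field_simps)
  qed
  have Qe: "Q x * (z1 x - z2 x) = \<bar>z1 x\<bar> powr p - \<bar>z2 x\<bar> powr p" for x
    by (simp add: Q_def)
  have m: "(\<lambda>x. \<bar>z1 x\<bar> powr p - \<bar>z2 x\<bar> powr p) \<in> borel_measurable (lebesgue_on {a..b})"
    by (rule continuous_imp_measurable_on_sets_lebesgue)
      (use p1 in \<open>auto intro!: continuous_intros continuous_on_powr' c1 c2\<close>)
  have m2: "(\<lambda>x. z1 x - z2 x) \<in> borel_measurable (lebesgue_on {a..b})"
    by (rule continuous_imp_measurable_on_sets_lebesgue) (auto intro!: continuous_intros c1 c2)
  have Qm: "Q \<in> borel_measurable (lebesgue_on {a..b})"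
    unfolding Q_def using m m2 by (rule borel_measurable_divide)
  have z: "z1 x = z2 x" if x: "x \<in> {a..b}" for x
  proof -
    have "z1 x - z2 x = 0"
    proof (rule linear_ode_zero[where d = "\<lambda>x. z1 x - z2 x" and x = x])
      show "AI a b (\<lambda>x. ((q - 1) * R x) * Q x)"
        by (rule AI_mult_bounded[OF AI_cmult[OF R] Qm Qb])
      show "ac_on a b (\<lambda>x. z1 x - z2 x) (\<lambda>x. ((q - 1) * R x) * Q x * (z1 x - z2 x))"
        by (rule ac_on_cong[OF ac_on_diff[OF z1 z2]]) (simp_all only: mult.assoc Qe, simp_all add: algebra_simps)
    qed (use eq x in \<open>auto simp: z1_def z2_def\<close>)
    then show ?thesis by simp
  qed
  \<comment> \<open>With a common ratio z, u = z phi_q(w) gives phi_p(u) = phi_p(z) w. The equation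
    for w becomes linear, hence w is determined as well.\<close>
  have u: "u1 x = z1 x * phi q (w1 x)" "u2 x = z1 x * phi q (w2 x)" if "x \<in> {a..b}" for x
    using nz[OF that] by (simp add: z1_def, simp add: z[OF that] z2_def)
  have w: "w1 x = w2 x"
  proof -
    have w1: "ac_on a b w1 (\<lambda>x. - (R x * phi p (u1 x)))" and w2: "ac_on a b w2 (\<lambda>x. - (R x * phi p (u2 x)))"
      using s1 s2 by (auto simp: sys_def)
    have "w1 x - w2 x = 0"
    proof (rule linear_ode_zero[where d = "\<lambda>x. w1 x - w2 x" and x = x])
      show "AI a b (\<lambda>x. - R x * phi p (z1 x))"
        by (intro AI_mult_continuous AI_minus R cont_phi_compose c1)
      show "ac_on a b (\<lambda>x. w1 x - w2 x) (\<lambda>x. - R x * phi p (z1 x) * (w1 x - w2 x))"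
        by (rule ac_on_cong[OF ac_on_diff[OF w1 w2]]) (auto simp: u phi_mult phi_phi algebra_simps)
    qed (use eq x in auto)
    then show ?thesis by simp
  qed
  then show ?thesis using u[OF x] by simp
qed

text \<open>Exchanging the unknowns and the exponents preserves the form of the system. The chart
  with nonzero w therefore also serves where u is nonzero.\<close>

lemma sys_swap: "conjugate_exponents.sys q p a b (\<lambda>x. - R x) (\<lambda>x. - B x) w u \<longleftrightarrow> sys a b B R u w"
  unfolding conjugate_exponents.sys_def[OF swap] sys_def by auto

lemma sys_subinterval: "sys a b B R u w \<Longrightarrow> a \<le> c \<Longrightarrow> d \<le> b \<Longrightarrow> sys c d B R u w"
  unfolding sys_def by (auto intro: ac_on_subinterval)

text \<open>A solution that avoids the origin is, near each point, inside one of the two charts.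
  Bisection chains the local uniqueness statements.\<close>

lemma sys_unique:
  assumes ab: "a \<le> b" and B: "AI a b B" and R: "AI a b R"
    and s1: "sys a b B R u1 w1" and s2: "sys a b B R u2 w2"
    and eq: "u1 a = u2 a" "w1 a = w2 a"
    and nz: "\<And>x. x \<in> {a..b} \<Longrightarrow> u2 x \<noteq> 0 \<or> w2 x \<noteq> 0"
    and x: "x \<in> {a..b}"
  shows "u1 x = u2 x \<and> w1 x = w2 x"
proof -
  interpret qp: conjugate_exponents q p by (rule swap)
  define e where "e x \<longleftrightarrow> u1 x = u2 x \<and> w1 x = w2 x" for x
  \<comment> \<open>\<open>P\<close> propagates agreement from the left endpoint to the right, which
    is the form that composes over adjacent intervals.\<close>
  define P where "P s t \<longleftrightarrow> (a \<le> s \<and> t \<le> b \<and> e s \<longrightarrow> (\<forall>y\<in>{s..t}. e y))" for s t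
  have c: "continuous_on {a..b} u1" "continuous_on {a..b} w1" "continuous_on {a..b} u2" "continuous_on {a..b} w2"
    using s1 s2 by (auto simp: sys_def intro: ac_on_continuous)
  have "P a b"
  proof (rule Bolzano[OF ab])
    fix s t r assume "P s t" "P t r" "s \<le> t" "t \<le> r"
    then show "P s r" unfolding P_def
      by (metis atLeastAtMost_iff nle_le order_trans)
  next
    fix y assume "a \<le> y" "y \<le> b"
    then have y: "y \<in> {a..b}" by simp
    show "\<exists>d>0. \<forall>s t. s \<le> y \<and> y \<le> t \<and> t - s < d \<longrightarrow> P s t"
    proof (cases "e y")
      case True
      \<comment> \<open>Agreement at y lets \<open>nz\<close>, stated for the second solution, put
        both solutions in the same chart.\<close>
      then consider "w1 y \<noteq> 0" "w2 y \<noteq> 0" | "u1 y \<noteq> 0" "u2 y \<noteq> 0"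
        using nz[OF y] by (auto simp: e_def)
      then show ?thesis
      proof cases
        case 1
        obtain d1 where d1: "d1 > 0" "\<forall>t\<in>{a..b}. \<bar>t - y\<bar> < d1 \<longrightarrow> w1 t \<noteq> 0"
          using continuous_on_nonzero_near[OF c(2) y 1(1)] by blast
        obtain d2 where d2: "d2 > 0" "\<forall>t\<in>{a..b}. \<bar>t - y\<bar> < d2 \<longrightarrow> w2 t \<noteq> 0"
          using continuous_on_nonzero_near[OF c(4) y 1(2)] by blast
        show ?thesis
        proof (intro exI[of _ "min d1 d2"] conjI allI impI)
          show "0 < min d1 d2" using d1 d2 by simp
          fix s t assume st: "s \<le> y \<and> y \<le> t \<and> t - s < min d1 d2"
          show "P s t" unfolding P_def
          proof (intro impI ballI)
            fix x assume as: "a \<le> s \<and> t \<le> b \<and> e s" and x: "x \<in> {s..t}"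
            have "u1 x = u2 x \<and> w1 x = w2 x"
              by (rule sys_unique_chart[OF _ _ sys_subinterval[OF s1] sys_subinterval[OF s2] _ _ _ _ x])
                (use as st d1 d2 AI_subinterval[OF B] AI_subinterval[OF R] in \<open>auto simp: e_def\<close>)
            then show "e x" by (simp add: e_def)
          qed
        qed
      next
        case 2
        obtain d1 where d1: "d1 > 0" "\<forall>t\<in>{a..b}. \<bar>t - y\<bar> < d1 \<longrightarrow> u1 t \<noteq> 0"
          using continuous_on_nonzero_near[OF c(1) y 2(1)] by blast
        obtain d2 where d2: "d2 > 0" "\<forall>t\<in>{a..b}. \<bar>t - y\<bar> < d2 \<longrightarrow> u2 t \<noteq> 0"
          using continuous_on_nonzero_near[OF c(3) y 2(2)] by blast
        show ?thesis
        proof (intro exI[of _ "min d1 d2"] conjI allI impI)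
          show "0 < min d1 d2" using d1 d2 by simp
          fix s t assume st: "s \<le> y \<and> y \<le> t \<and> t - s < min d1 d2"
          show "P s t" unfolding P_def
          proof (intro impI ballI)
            fix x assume as: "a \<le> s \<and> t \<le> b \<and> e s" and x: "x \<in> {s..t}"
            have "w1 x = w2 x \<and> u1 x = u2 x"
              by (rule qp.sys_unique_chart[OF _ _ sys_swap[THEN iffD2, OF sys_subinterval[OF s1]] sys_swap[THEN iffD2, OF sys_subinterval[OF s2]] _ _ _ _ x])
                (use as st d1 d2 AI_minus[OF AI_subinterval[OF B]] AI_minus[OF AI_subinterval[OF R]] in \<open>auto simp: e_def\<close>)
            then show "e x" by (simp add: e_def)
          qed
        qed
      qed
    next
      case False
      \<comment> \<open>If the solutions differ at y they differ nearby, so the premise of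
        \<open>P\<close> fails at every left endpoint close to y and \<open>P\<close> holds
        vacuously.\<close>
      then have "\<bar>u1 y - u2 y\<bar> + \<bar>w1 y - w2 y\<bar> \<noteq> 0" by (auto simp: e_def)
      then obtain d where d: "d > 0" "\<forall>t\<in>{a..b}. \<bar>t - y\<bar> < d \<longrightarrow> \<bar>u1 t - u2 t\<bar> + \<bar>w1 t - w2 t\<bar> \<noteq> 0"
        using continuous_on_nonzero_near[OF _ y, of "\<lambda>t. \<bar>u1 t - u2 t\<bar> + \<bar>w1 t - w2 t\<bar>"]
          continuous_on_add[OF continuous_on_rabs[OF continuous_on_diff[OF c(1,3)]] continuous_on_rabs[OF continuous_on_diff[OF c(2,4)]]]
        by blast
      show ?thesis
      proof (intro exI[of _ d] conjI allI impI d(1))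
        fix s t assume st: "s \<le> y \<and> y \<le> t \<and> t - s < d"
        show "P s t" unfolding P_def using d(2)[rule_format, of s] st \<open>y \<le> b\<close> by (auto simp: e_def)
      qed
    qed
  qed
  then show ?thesis using eq x by (auto simp: P_def e_def)
qed

text \<open>The origin lies in neither chart. There the energy E = |u|^p + |w|^q is used: E' = (p B
  - q R) phi_p(u) phi_q(w), and by \<open>Young_phi\<close> the product is Q E with |Q| at most 1.
  So E solves a homogeneous linear equation with integrable coefficient. Where E = 0 the quotient Q
  is 0 / 0 = 0 and the identity still holds.\<close>

lemma sys_zero:
  assumes B: "AI a b B" and R: "AI a b R"
    and s: "sys a b B R u w" and eq: "u a = 0" "w a = 0" and x: "x \<in> {a..b}"
  shows "u x = 0"
proof -
  interpret qp: conjugate_exponents q p by (rule swap)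
  have u: "ac_on a b u (\<lambda>x. B x * phi q (w x))" and w: "ac_on a b w (\<lambda>x. - (R x * phi p (u x)))"
    using s by (auto simp: sys_def)
  note cu = ac_on_continuous[OF u] and cw = ac_on_continuous[OF w]
  have 1: "ac_on a b (\<lambda>x. \<bar>u x\<bar> powr p) (\<lambda>x. p * phi p (u x) * (B x * phi q (w x)))"
    by (rule ac_on_chain[OF u]) (auto intro!: DERIV_abs_powr continuous_intros cont_phi_compose cu)
  have 2: "ac_on a b (\<lambda>x. \<bar>w x\<bar> powr q) (\<lambda>x. q * phi q (w x) * - (R x * phi p (u x)))"
    by (rule ac_on_chain[OF w]) (auto intro!: qp.DERIV_abs_powr continuous_intros qp.cont_phi_compose cw)
  define E where "E x = \<bar>u x\<bar> powr p + \<bar>w x\<bar> powr q" for x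
  define Q where "Q x = phi p (u x) * phi q (w x) / E x" for x
  have E: "ac_on a b E (\<lambda>x. p * phi p (u x) * (B x * phi q (w x)) + q * phi q (w x) * - (R x * phi p (u x)))"
    unfolding E_def by (rule ac_on_add[OF 1 2])
  have Qb: "\<bar>Q x\<bar> \<le> 1" for x
    using Young_phi[of "u x" "w x"] unfolding Q_def E_def abs_divide
    by (intro divide_le_eq_1[THEN iffD2]) (auto simp: add_nonneg_eq_0_iff less_le)
  have QE: "Q x * E x = phi p (u x) * phi q (w x)" for x
    using Young_phi[of "u x" "w x"] unfolding Q_def E_def by auto
  have "(\<lambda>x. phi p (u x) * phi q (w x)) \<in> borel_measurable (lebesgue_on {a..b})"
    "E \<in> borel_measurable (lebesgue_on {a..b})"
    by (rule continuous_imp_measurable_on_sets_lebesgue;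
        auto intro!: continuous_intros cont_phi_compose qp.cont_phi_compose cu cw ac_on_continuous[OF E])+
  then have Qm: "Q \<in> borel_measurable (lebesgue_on {a..b})"
    unfolding Q_def by (rule borel_measurable_divide)
  have "E x = 0"
  proof (rule linear_ode_zero[OF _ _ _ x])
    show "AI a b (\<lambda>x. (p * B x - q * R x) * Q x)"
      by (rule AI_mult_bounded[OF AI_diff[OF AI_cmult[OF B] AI_cmult[OF R]] Qm Qb])
    show "ac_on a b E (\<lambda>x. (p * B x - q * R x) * Q x * E x)"
      by (rule ac_on_cong[OF E]) (simp_all add: mult.assoc QE, simp_all add: algebra_simps)
    show "E a = 0" using eq by (simp add: E_def)
  qed
  then show ?thesis by (simp add: E_def add_nonneg_eq_0_iff)
qed

text \<open>A nontrivial solution with u(0) = 0 has w(0) nonzero, hence is a rescaling of the polar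
  solution starting at (0, 1); its zeros are those of the sine of the angle.\<close>

lemma sys_nontrivial_iff:
  assumes L: "0 < L" and B: "AI 0 L B" and R: "AI 0 L R" and s: "angle_sol L B R \<theta>"
    and Bp: "AE x in lebesgue. x \<in> {0..L} \<longrightarrow> 0 < B x" "\<And>x. 0 \<le> B x"
  shows "(\<exists>u w. sys 0 L B R u w \<and> u 0 = 0 \<and> u L = 0 \<and> (\<exists>x\<in>{0..L}. u x \<noteq> 0)) \<longleftrightarrow> sin (\<theta> L) = 0"
proof -
  interpret qp: conjugate_exponents q p by (rule swap)
  obtain k where k: "sys 0 L B R (\<lambda>x. exp (k x) * sin (\<theta> x)) (\<lambda>x. exp ((p - 1) * k x) * cos (\<theta> x))" "k 0 = 0"
    using sys_of_angle[OF B R s] by blast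
  define U where "U x = exp (k x) * sin (\<theta> x)" for x
  define W where "W x = exp ((p - 1) * k x) * cos (\<theta> x)" for x
  have UW: "sys 0 L B R U W" using k(1) unfolding U_def W_def .
  have 0: "U 0 = 0" "W 0 = 1" using s k(2) by (auto simp: U_def W_def angle_sol_def)
  have UL: "U L = 0 \<longleftrightarrow> sin (\<theta> L) = 0" by (simp add: U_def)
  have nz: "U x \<noteq> 0 \<or> W x \<noteq> 0" for x
    using sin_zero_abs_cos_one[of "\<theta> x"] by (auto simp: U_def W_def)
  show ?thesis
  proof
    assume "\<exists>u w. sys 0 L B R u w \<and> u 0 = 0 \<and> u L = 0 \<and> (\<exists>x\<in>{0..L}. u x \<noteq> 0)"
    then obtain u w x where u: "sys 0 L B R u w" "u 0 = 0" "u L = 0" and x: "x \<in> {0..L}" "u x \<noteq> 0" by blast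
    then have w0: "w 0 \<noteq> 0" using sys_zero[OF B R u(1,2) _ x(1)] by blast
    \<comment> \<open>Chosen so that \<open>phi p c = w 0\<close>: the scaled polar solution then
      starts at (0, w 0).\<close>
    define c where "c = phi q (w 0)"
    have c: "c \<noteq> 0" "phi p c = w 0" using w0 by (auto simp: c_def phi_phi)
    have "u L = c * U L \<and> w L = phi p c * W L"
      by (rule sys_unique[OF _ B R u(1) sys_scale[OF UW, of c]]) (use L u 0 c nz in auto)
    then show "sin (\<theta> L) = 0" using u c UL by simp
  next
    assume "sin (\<theta> L) = 0"
    \<comment> \<open>That \<open>U\<close> is not identically zero uses positivity of
      \<open>B\<close>: near 0 the component \<open>W\<close> stays positive, so \<open>U\<close>
      has an almost everywhere positive derivative.\<close>
    moreover have "\<exists>x\<in>{0..L}. U x \<noteq> 0"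
    proof -
      have U: "ac_on 0 L U (\<lambda>x. B x * phi q (W x))" and W: "continuous_on {0..L} W"
        using UW by (auto simp: sys_def intro: ac_on_continuous)
      obtain d where d: "d > 0" "\<forall>t\<in>{0..L}. \<bar>t - 0\<bar> < d \<longrightarrow> \<bar>W t - W 0\<bar> < 1"
        using W L unfolding continuous_on_iff dist_real_def by (metis atLeastAtMost_iff less_eq_real_def zero_less_one)
      define e where "e = min (d / 2) L"
      have e: "0 < e" "e \<le> L" using d L by (auto simp: e_def)
      have Wp: "0 < W t" if "t \<in> {0..e}" for t
        using d(2)[rule_format, of t] that 0 d(1) by (auto simp: e_def)
      have Wq: "0 < phi q (W t)" if "t \<in> {0..e}" for t
        using Wp[OF that] by (simp add: phi_pos)
      have "0 < integral {0..e} (\<lambda>x. B x * phi q (W x))"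
      proof (rule integral_pos_AE[OF _ e(1)])
        show "AI 0 e (\<lambda>x. B x * phi q (W x))" by (rule AI_subinterval[OF ac_on_AI[OF U]]) (use e in auto)
        show "0 \<le> B x * phi q (W x)" if "x \<in> {0..e}" for x using Wq[OF that] Bp(2) by simp
        show "AE x in lebesgue. x \<in> {0..e} \<longrightarrow> 0 < B x * phi q (W x)"
          using Bp(1) by eventually_elim (use Wq e in auto)
      qed
      then have "U e \<noteq> 0" using ac_on_diff_eq[OF U, of 0 e] e 0 by simp
      then show ?thesis using e by (intro bexI[of _ e]) auto
    qed
    ultimately show "\<exists>u w. sys 0 L B R u w \<and> u 0 = 0 \<and> u L = 0 \<and> (\<exists>x\<in>{0..L}. u x \<noteq> 0)"
      using UW 0 UL by blast
  qed
qed

end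

section \<open>Averaging of periodic coefficients\<close>


lemma integral_stretch:
  fixes f :: "real \<Rightarrow> real"
  assumes "f integrable_on {0..x / e}" "0 < e"
  shows "((\<lambda>t. f (t / e)) has_integral e * integral {0..x / e} f) {0..x}"
proof -
  have im: "(\<lambda>t. t / (1 / e)) ` {0..x / e} = {0..x}"
    using assms(2) image_mult_atLeastAtMost[of e 0 "x / e"] by (simp add: mult.commute)
  have "1 / e \<noteq> 0" using assms(2) by simp
  from has_integral_stretch_real[OF integrable_integral[OF assms(1)] this]
  show ?thesis using assms(2) unfolding im by simp
qed

lemma AI_stretch:
  assumes "AI 0 (x / e) f" "0 < e"
  shows "AI 0 x (\<lambda>t. f (t / e))"
  using integral_stretch[OF AI_integrable[OF assms(1)] assms(2)]
    integral_stretch[OF AI_integrable[OF AI_abs[OF assms(1)]] assms(2)]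
  by (intro absolutely_integrable_onI) auto

lemma periodic_integral_shift:
  assumes "periodic L f"
  shows "integral {L..y + L} f = integral {0..y} f"
proof -
  have "f \<circ> ((+) L) = f" using assms by (auto simp: periodic_def add.commute)
  then show ?thesis using integral_shift_Icc_real[of 0 y f L] by simp
qed

lemma periodic_AI_shift:
  assumes "periodic L f" "AI 0 y f"
  shows "AI L (y + L) f"
proof -
  have "f \<circ> ((+) L) = f" "(\<lambda>x. norm (f x)) \<circ> ((+) L) = (\<lambda>x. norm (f x))"
    using assms(1) by (auto simp: periodic_def add.commute)
  then show ?thesis
    using assms(2) integrable_on_shift_Icc_real[of f L 0 y] integrable_on_shift_Icc_real[of "\<lambda>x. norm (f x)" L 0 y]
    unfolding absolutely_integrable_on_def by simp
qed

lemma periodic_AI: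
  assumes L: "0 < L" and f: "periodic L f" "AI 0 L f"
  shows "AI 0 y f"
proof -
  have n: "AI 0 (real n * L) f" for n
  proof (induction n)
    case (Suc n)
    have "AI 0 (real n * L + L) f"
      by (rule absolutely_integrable_on_combine[OF f(2) periodic_AI_shift[OF f(1) Suc]]) (use L in auto)
    then show ?case by (simp add: algebra_simps)
  qed (auto intro: absolutely_integrable_negligible)
  obtain n where "y / L \<le> real n" using real_arch_simple by blast
  then have "y \<le> real n * L" using L by (simp add: field_simps)
  then show ?thesis using AI_subinterval[OF n] by blast
qed

text \<open>Whole periods contribute nothing, so only the integral over part of one period
  remains.\<close>

lemma periodic_mean_zero_integral_bound:
  assumes L: "0 < L" and f: "periodic L f" "AI 0 L f" and m: "integral {0..L} f = 0" and y: "0 \<le> y"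
  shows "\<bar>integral {0..y} f\<bar> \<le> integral {0..L} (\<lambda>x. \<bar>f x\<bar>)"
proof -
  have n: "\<bar>integral {0..y} f\<bar> \<le> integral {0..L} (\<lambda>x. \<bar>f x\<bar>)" if "0 \<le> y" "y \<le> real (Suc n) * L" for n y
    using that
  proof (induction n arbitrary: y)
    case 0
    have "integral {0..y} (\<lambda>x. \<bar>f x\<bar>) \<le> integral {0..L} (\<lambda>x. \<bar>f x\<bar>)"
      by (rule integral_subset_le) (use 0 AI_integrable_sub[OF AI_abs[OF f(2)]] in auto)
    then show ?case using integral_abs_le[OF f(2), of 0 y] 0 by simp
  next
    case (Suc n)
    show ?case
    proof (cases "y \<le> L")
      case True
      moreover have "L \<le> real (Suc n) * L" using L by simp
      ultimately have "y \<le> real (Suc n) * L" by linarith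
      then show ?thesis using Suc by blast
    next
      case False
      have "integral {0..L} f + integral {L..y} f = integral {0..y} f"
        by (rule Henstock_Kurzweil_Integration.integral_combine) (use False L AI_integrable[OF periodic_AI[OF L f]] in auto)
      then have "integral {0..y} f = integral {0..y - L} f"
        using m periodic_integral_shift[OF f(1), of "y - L"] by simp
      then show ?thesis using Suc.IH[of "y - L"] False Suc.prems by (simp add: algebra_simps)
    qed
  qed
  obtain n where "y / L \<le> real n" using real_arch_simple by blast
  then have "y \<le> real (Suc n) * L" using L by (simp add: field_simps)
  then show ?thesis using n y by blast
qed

text \<open>Substitution turns the primitive of the deviation into e times a primitive of a periodic
  function of mean zero. The constant 3 is 1 + 2: the integral of |f(x/e)| exceeds that of |f| by at
  most e, which is at most 1, times the integral of the deviation of |f| from its mean, and the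
  latter is at most twice the integral of |f|.\<close>

lemma oscillating_bounds:
  assumes L: "0 < L" and f: "periodic L f" "AI 0 L f" and e: "0 < e" "e \<le> 1"
  shows "AI 0 L (\<lambda>x. f (x / e))"
    and "x \<in> {0..L} \<Longrightarrow> \<bar>integral {0..x} (\<lambda>t. f (t / e) - average L f)\<bar> \<le> e * integral {0..L} (\<lambda>t. \<bar>f t - average L f\<bar>)"
    and "integral {0..L} (\<lambda>x. \<bar>f (x / e)\<bar>) \<le> 3 * integral {0..L} (\<lambda>x. \<bar>f x\<bar>)"
proof -
  show AIe: "AI 0 L (\<lambda>x. f (x / e))"
    by (rule AI_stretch[OF periodic_AI[OF L f] e(1)])
  have mean: "integral {0..L} (\<lambda>t. g t - average L g) = 0" if "AI 0 L g" for g
    using L AI_integrable[OF that] by (subst integral_diff) (auto simp: average_def)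
  have *: "\<bar>integral {0..x} (\<lambda>t. g (t / e) - average L g)\<bar> \<le> e * integral {0..L} (\<lambda>t. \<bar>g t - average L g\<bar>)"
    if g: "periodic L g" "AI 0 L g" and x: "0 \<le> x" for x g
  proof -
    let ?h = "\<lambda>t. g t - average L g"
    have h: "periodic L ?h" "AI 0 L ?h"
      using g by (auto simp: periodic_def intro!: AI_diff AI_const)
    have "integral {0..x} (\<lambda>t. ?h (t / e)) = e * integral {0..x / e} ?h"
      by (rule integral_unique[OF integral_stretch[OF AI_integrable[OF periodic_AI[OF L h]] e(1)]])
    then show ?thesis
      using periodic_mean_zero_integral_bound[OF L h mean[OF g(2)], of "x / e"] x e(1) by (simp add: abs_mult)
  qed
  show "\<bar>integral {0..x} (\<lambda>t. f (t / e) - average L f)\<bar> \<le> e * integral {0..L} (\<lambda>t. \<bar>f t - average L f\<bar>)"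
    if "x \<in> {0..L}"
    using *[OF f, of x] that by simp
  show "integral {0..L} (\<lambda>x. \<bar>f (x / e)\<bar>) \<le> 3 * integral {0..L} (\<lambda>x. \<bar>f x\<bar>)"
  proof -
    define g where "g t = \<bar>f t\<bar>" for t
    have g: "periodic L g" "AI 0 L g"
      using f by (auto simp: periodic_def g_def[abs_def] intro!: AI_abs)
    define I where "I = integral {0..L} g"
    have I: "0 \<le> I" unfolding I_def by (rule integral_nonneg[OF AI_integrable[OF g(2)]]) (simp add: g_def)
    have A: "average L g = I / L" by (simp add: average_def I_def)
    have i: "(\<lambda>t. g (t / e)) integrable_on {0..L}"
      by (rule AI_integrable[OF AI_stretch[OF periodic_AI[OF L g] e(1)]])
    have "integral {0..L} (\<lambda>t. g (t / e)) - I = integral {0..L} (\<lambda>t. g (t / e) - average L g)"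
      using i L by (subst integral_diff) (auto simp: A)
    also have "\<dots> \<le> e * integral {0..L} (\<lambda>t. \<bar>g t - average L g\<bar>)"
      using *[OF g, of L] L by simp
    also have "\<dots> \<le> 1 * integral {0..L} (\<lambda>t. \<bar>g t - average L g\<bar>)"
      using e by (intro mult_right_mono integral_nonneg AI_integrable AI_abs AI_diff g AI_const) auto
    also have "\<dots> \<le> 1 * integral {0..L} (\<lambda>t. g t + I / L)"
      using I L by (intro mult_left_mono integral_le AI_integrable AI_abs AI_diff g AI_const AI_add) (auto simp: A g_def abs_le_iff)
    also have "\<dots> = 2 * I"
      using AI_integrable[OF g(2)] L by (subst integral_add) (auto simp: I_def)
    finally show ?thesis by (simp add: g_def[abs_def] I_def)
  qed
qed

text \<open>Only the primitive \<open>N\<close> of the oscillating factor is small. Integration by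
  parts moves the derivative to \<open>g\<close>, and \<open>N 0 = 0\<close> leaves a single
  boundary term.\<close>

lemma oscillating_weak_bound:
  assumes N: "ac_on 0 L N n" "N 0 = 0" "\<And>x. x \<in> {0..L} \<Longrightarrow> \<bar>N x\<bar> \<le> c"
    and g: "ac_on 0 L g g'" and x: "x \<in> {0..L}"
  shows "\<bar>integral {0..x} (\<lambda>t. n t * g t)\<bar> \<le> c * (\<bar>g x\<bar> + integral {0..L} (\<lambda>t. \<bar>g' t\<bar>))"
proof -
  have ng: "AI 0 L (\<lambda>t. n t * g t)" "AI 0 L (\<lambda>t. N t * g' t)"
    by (intro AI_mult_continuous AI_mult_continuous_left ac_on_AI[OF N(1)] ac_on_AI[OF g] ac_on_continuous[OF N(1)] ac_on_continuous[OF g])+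
  have c0: "0 \<le> c" using N(3)[OF x] by linarith
  have "N x * g x = integral {0..x} (\<lambda>t. n t * g t + N t * g' t)"
    using ac_onD[OF ac_on_mult[OF N(1) g] x] N(2) by simp
  also have "\<dots> = integral {0..x} (\<lambda>t. n t * g t) + integral {0..x} (\<lambda>t. N t * g' t)"
    by (rule integral_add) (use x AI_integrable_sub ng in auto)
  finally have "integral {0..x} (\<lambda>t. n t * g t) = N x * g x - integral {0..x} (\<lambda>t. N t * g' t)" by simp
  moreover have "\<bar>N x * g x\<bar> \<le> c * \<bar>g x\<bar>"
    using N(3)[OF x] by (simp add: abs_mult mult_right_mono)
  moreover have "norm (integral {0..x} (\<lambda>t. N t * g' t)) \<le> integral {0..x} (\<lambda>t. c * \<bar>g' t\<bar>)"
  proof (rule integral_norm_bound_integral)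
    show "(\<lambda>t. N t * g' t) integrable_on {0..x}" "(\<lambda>t. c * \<bar>g' t\<bar>) integrable_on {0..x}"
      by (rule AI_integrable_sub[OF ng(2)], use x in simp_all)
        (rule AI_integrable_sub[OF AI_cmult[OF AI_abs[OF ac_on_AI[OF g]]]], use x in simp_all)
    show "norm (N t * g' t) \<le> c * \<bar>g' t\<bar>" if "t \<in> {0..x}" for t
      using N(3)[of t] that x by (auto simp: abs_mult intro!: mult_right_mono)
  qed
  moreover have "integral {0..x} (\<lambda>t. c * \<bar>g' t\<bar>) \<le> integral {0..L} (\<lambda>t. c * \<bar>g' t\<bar>)"
    by (rule integral_subset_le) (use x c0 AI_integrable_sub[OF AI_cmult[OF AI_abs[OF ac_on_AI[OF g]]]] in auto)
  ultimately show ?thesis by (simp add: distrib_left)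
qed

context conjugate_exponents
begin

text \<open>A solution is determined on [0, L] but arbitrary outside, hence a choice; uniqueness
  makes the value at L independent of it.\<close>

definition end_angle :: "real \<Rightarrow> (real \<Rightarrow> real) \<Rightarrow> (real \<Rightarrow> real) \<Rightarrow> real" where
  "end_angle L B R = (SOME \<theta>. angle_sol L B R \<theta>) L"

lemma end_angle_eq:
  assumes "0 < L" "AI 0 L B" "AI 0 L R" "angle_sol L B R \<theta>"
  shows "end_angle L B R = \<theta> L"
  unfolding end_angle_def
  by (rule angle_sol_unique[OF assms(2,3,4) someI[of "angle_sol L B R", OF assms(4)]]) (use assms(1) in simp)

text \<open>The averaged angle is the reference solution in \<open>angle_sol_perturbation\<close>.
  The two weights are then tested against fixed absolutely continuous functions, and the Gronwall
  constant depends only on bounds for the oscillating coefficients that are uniform in e.\<close>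

theorem averaging:
  assumes L: "0 < L" and b: "periodic L b" "AI 0 L b" and r: "periodic L r" "AI 0 L r"
  shows "((\<lambda>e. end_angle L (\<lambda>x. c * b (x / e)) (\<lambda>x. r (x / e))) \<longlongrightarrow>
     end_angle L (\<lambda>x. c * average L b) (\<lambda>x. average L r)) (at_right 0)"
proof -
  define B0 R0 where "B0 = c * average L b" and "R0 = average L r"
  have B0: "AI 0 L (\<lambda>x. B0)" and R0: "AI 0 L (\<lambda>x. R0)" by (rule AI_const)+
  obtain \<theta> where \<theta>: "angle_sol L (\<lambda>x. B0) (\<lambda>x. R0) \<theta>"
    using angle_sol_exists[OF L B0 R0] by blast
  have \<theta>ac: "ac_on 0 L \<theta> (\<lambda>x. B0 * F (\<theta> x) + R0 * G (\<theta> x))" by (rule angle_sol_ac[OF \<theta>])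
  have cf: "ac_on 0 L (\<lambda>x. F (\<theta> x)) (\<lambda>x. F' (\<theta> x) * (B0 * F (\<theta> x) + R0 * G (\<theta> x)))"
    by (rule ac_on_chain[OF \<theta>ac DERIV_F]) (rule continuous_on_compose2[OF cont_F'[of UNIV] ac_on_continuous[OF \<theta>ac]], simp)
  have cg: "ac_on 0 L (\<lambda>x. G (\<theta> x)) (\<lambda>x. G' (\<theta> x) * (B0 * F (\<theta> x) + R0 * G (\<theta> x)))"
    by (rule ac_on_chain[OF \<theta>ac DERIV_G]) (rule continuous_on_compose2[OF cont_G'[of UNIV] ac_on_continuous[OF \<theta>ac]], simp)
  \<comment> \<open>Supremum bound plus total variation of the test function, as required by
    \<open>oscillating_weak_bound\<close>; \<open>vg\<close> is the analogue for
    \<open>G\<close>.\<close>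
  define vf where "vf = C + integral {0..L} (\<lambda>x. \<bar>F' (\<theta> x) * (B0 * F (\<theta> x) + R0 * G (\<theta> x))\<bar>)"
  define vg where "vg = C + integral {0..L} (\<lambda>x. \<bar>G' (\<theta> x) * (B0 * F (\<theta> x) + R0 * G (\<theta> x))\<bar>)"
  define mb where "mb = integral {0..L} (\<lambda>t. \<bar>b t - average L b\<bar>)"
  define mr where "mr = integral {0..L} (\<lambda>t. \<bar>r t - average L r\<bar>)"
  have mb0: "0 \<le> mb" unfolding mb_def by (intro integral_nonneg AI_integrable AI_abs AI_diff b AI_const) auto
  have mr0: "0 \<le> mr" unfolding mr_def by (intro integral_nonneg AI_integrable AI_abs AI_diff r AI_const) auto
  \<comment> \<open>The factors 3 come from \<open>oscillating_bounds\<close> and make K independent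
    of e.\<close>
  define K where "K = C * (\<bar>c\<bar> * (3 * integral {0..L} (\<lambda>x. \<bar>b x\<bar>)) + 3 * integral {0..L} (\<lambda>x. \<bar>r x\<bar>))"
  define M where "M = (\<bar>c\<bar> * mb * vf + mr * vg) * (1 + exp (2 * K) * K)"
  have bound: "\<bar>end_angle L (\<lambda>x. c * b (x / e)) (\<lambda>x. r (x / e)) - \<theta> L\<bar> \<le> e * M"
    if e: "0 < e" "e \<le> 1" for e
  proof -
    note ob = oscillating_bounds[OF L b e] and orr = oscillating_bounds[OF L r e]
    have Be: "AI 0 L (\<lambda>x. c * b (x / e))" by (rule AI_cmult[OF ob(1)])
    obtain \<phi> where \<phi>: "angle_sol L (\<lambda>x. c * b (x / e)) (\<lambda>x. r (x / e)) \<phi>"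
      using angle_sol_exists[OF L Be orr(1)] by blast
    have "\<bar>\<phi> L - \<theta> L\<bar> \<le> (e * (\<bar>c\<bar> * mb * vf + mr * vg)) * (1 + exp (2 * K) * K)"
    proof (rule angle_sol_perturbation[OF B0 Be R0 orr(1) \<theta> \<phi>])
      have "integral {0..L} (\<lambda>x. \<bar>c * b (x / e)\<bar> + \<bar>r (x / e)\<bar>)
        = \<bar>c\<bar> * integral {0..L} (\<lambda>x. \<bar>b (x / e)\<bar>) + integral {0..L} (\<lambda>x. \<bar>r (x / e)\<bar>)"
        unfolding abs_mult
        by (subst integral_add)
          (intro AI_integrable AI_cmult AI_abs ob(1) orr(1) | simp)+
      also have "\<dots> \<le> \<bar>c\<bar> * (3 * integral {0..L} (\<lambda>x. \<bar>b x\<bar>)) + 3 * integral {0..L} (\<lambda>x. \<bar>r x\<bar>)"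
        by (intro add_mono mult_left_mono ob(3) orr(3)) auto
      finally show "C * integral {0..L} (\<lambda>x. \<bar>c * b (x / e)\<bar> + \<bar>r (x / e)\<bar>) \<le> K"
        unfolding K_def using C_nonneg by (rule mult_left_mono)
      fix x assume x: "x \<in> {0..L}"
      have weak: "\<bar>integral {0..x} (\<lambda>t. (f (t / e) - average L f) * g t)\<bar>
         \<le> e * integral {0..L} (\<lambda>t. \<bar>f t - average L f\<bar>) * (C + integral {0..L} (\<lambda>t. \<bar>g' t\<bar>))"
        if f: "periodic L f" "AI 0 L f" and g: "ac_on 0 L g g'" "\<bar>g x\<bar> \<le> C" for f g g'
      proof -
        note of = oscillating_bounds[OF L f e]
        have AIn: "AI 0 L (\<lambda>t. f (t / e) - average L f)" by (intro AI_diff of(1) AI_const)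
        have "\<bar>integral {0..x} (\<lambda>t. (f (t / e) - average L f) * g t)\<bar>
         \<le> e * integral {0..L} (\<lambda>t. \<bar>f t - average L f\<bar>) * (\<bar>g x\<bar> + integral {0..L} (\<lambda>t. \<bar>g' t\<bar>))"
          by (rule oscillating_weak_bound[OF ac_on_integral[OF AIn, of 0] _ _ g(1) x]) (use of(2) in auto)
        also have "\<dots> \<le> e * integral {0..L} (\<lambda>t. \<bar>f t - average L f\<bar>) * (C + integral {0..L} (\<lambda>t. \<bar>g' t\<bar>))"
        proof (rule mult_left_mono)
          have "0 \<le> integral {0..L} (\<lambda>t. \<bar>f t - average L f\<bar>)"
            by (intro integral_nonneg AI_integrable AI_abs AI_diff f AI_const) auto
          then show "0 \<le> e * integral {0..L} (\<lambda>t. \<bar>f t - average L f\<bar>)" using e by simp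
        qed (use g(2) in simp)
        finally show ?thesis .
      qed
      have n: "AI 0 L (\<lambda>t. (b (t / e) - average L b) * F (\<theta> t))" "AI 0 L (\<lambda>t. (r (t / e) - average L r) * G (\<theta> t))"
        by (intro AI_mult_continuous AI_diff ob(1) orr(1) AI_const ac_on_continuous[OF cf] ac_on_continuous[OF cg])+
      have "integral {0..x} (\<lambda>t. (c * b (t / e) - B0) * F (\<theta> t) + (r (t / e) - R0) * G (\<theta> t))
        = integral {0..x} (\<lambda>t. c * ((b (t / e) - average L b) * F (\<theta> t)) + (r (t / e) - average L r) * G (\<theta> t))"
        by (rule integral_cong) (simp add: B0_def R0_def algebra_simps)
      also have "\<dots> = c * integral {0..x} (\<lambda>t. (b (t / e) - average L b) * F (\<theta> t)) + integral {0..x} (\<lambda>t. (r (t / e) - average L r) * G (\<theta> t))"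
        by (subst integral_add) (use x AI_integrable_sub[OF n(2)] AI_integrable_sub[OF AI_cmult[OF n(1)]] in auto)
      also have "\<bar>\<dots>\<bar> \<le> \<bar>c\<bar> * (e * mb * vf) + e * mr * vg"
        unfolding mb_def mr_def vf_def vg_def
        unfolding abs_mult[of c]
        by (intro order_trans[OF abs_triangle_ineq] add_mono weak[OF r cg G_bound]
            order_trans[OF eq_refl[OF abs_mult]] mult_left_mono weak[OF b cf F_bound] abs_ge_zero)
      finally show "\<bar>integral {0..x} (\<lambda>t. (c * b (t / e) - B0) * F (\<theta> t) + (r (t / e) - R0) * G (\<theta> t))\<bar>
        \<le> e * (\<bar>c\<bar> * mb * vf + mr * vg)" by (simp add: algebra_simps)
    qed (use L in simp)
    then show ?thesis
      unfolding end_angle_eq[OF L Be orr(1) \<phi>] M_def by (simp add: mult.assoc)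
  qed
  have "((\<lambda>e. end_angle L (\<lambda>x. c * b (x / e)) (\<lambda>x. r (x / e)) - \<theta> L) \<longlongrightarrow> 0) (at_right 0)"
  proof (rule Lim_null_comparison)
    show "((\<lambda>e. e * M) \<longlongrightarrow> 0) (at_right 0)" by (auto intro!: tendsto_eq_intros)
    have "\<forall>\<^sub>F e in at_right 0. e \<in> {0<..<1::real}" by (rule eventually_at_right_real) simp
    then show "\<forall>\<^sub>F e in at_right 0. norm (end_angle L (\<lambda>x. c * b (x / e)) (\<lambda>x. r (x / e)) - \<theta> L) \<le> e * M"
      by eventually_elim (use bound in auto)
  qed
  then have "((\<lambda>e. end_angle L (\<lambda>x. c * b (x / e)) (\<lambda>x. r (x / e))) \<longlongrightarrow> \<theta> L) (at_right 0)"
    by (rule LIM_zero_cancel)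
  then show ?thesis using end_angle_eq[OF L B0 R0 \<theta>] by (simp add: B0_def R0_def)
qed

end

section \<open>Eigenvalues\<close>


text \<open>Each \<open>s i\<close> lies on a level n(i) pi with n strictly increasing. By the
  intermediate value theorem every level up to n(k) is attained on the way from 0 to
  \<open>s k\<close>, hence by some \<open>s i\<close> with i at most k. So n maps {1..k}
  bijectively onto {1..n(k)}, and n(k) = k. The order of the eigenvalues alone fixes the
  level.\<close>

lemma enumerates_level:
  fixes g :: "real \<Rightarrow> real"
  assumes c: "continuous_on {0..} g" and m: "strict_mono_on {0..} g" and g0: "g 0 = 0"
    and en: "enumerates_by (\<lambda>\<mu>. \<mu>) s {\<mu>. 0 < \<mu> \<and> sin (g \<mu>) = 0}" and k: "1 \<le> k"
  shows "0 < s k \<and> g (s k) = real k * pi"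
proof -
  have S: "s ` {1..} = {\<mu>. 0 < \<mu> \<and> sin (g \<mu>) = 0}" and sm: "strict_mono_on {1..} s"
    using en by (auto simp: enumerates_by_def)
  have s: "0 < s i" "sin (g (s i)) = 0" if "1 \<le> i" for i
    using S that by auto
  have "\<exists>n::nat. 1 \<le> n \<and> g (s i) = real n * pi" if i: "1 \<le> i" for i
  proof -
    obtain z :: int where z: "g (s i) = of_int z * pi" using s(2)[OF i] by (auto simp: sin_zero_iff_int2)
    have "0 < g (s i)" using strict_mono_onD[OF m, of 0 "s i"] s(1)[OF i] g0 by simp
    then have "0 < z" using z by (simp add: zero_less_mult_iff)
    then show ?thesis using z by (intro exI[of _ "nat z"]) auto
  qed
  then obtain n :: "nat \<Rightarrow> nat" where n: "\<And>i. 1 \<le> i \<Longrightarrow> 1 \<le> n i \<and> g (s i) = real (n i) * pi" by metis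
  have nm: "n i < n j" if "1 \<le> i" "i < j" for i j
  proof -
    have "s i < s j" using strict_mono_onD[OF sm, of i j] that by simp
    then have "g (s i) < g (s j)" using strict_mono_onD[OF m, of "s i" "s j"] s(1) that by (simp add: less_imp_le)
    then show ?thesis using n[of i] n[of j] that by simp
  qed
  have inj: "inj_on n {1..k}"
    by (rule linorder_inj_onI) (use nm in \<open>auto dest: less_imp_neq\<close>)
  have sub: "n ` {1..k} \<subseteq> {1..n k}"
    using n nm by (auto simp: le_less)
  have sup: "{1..n k} \<subseteq> n ` {1..k}"
  proof
    fix j assume j: "j \<in> {1..n k}"
    have "\<exists>x\<ge>0. x \<le> s k \<and> g x = real j * pi"
      by (rule IVT') (use g0 j n[OF k] s(1)[OF k] in \<open>auto intro: continuous_on_subset[OF c]\<close>)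
    then obtain x where x: "0 \<le> x" "x \<le> s k" "g x = real j * pi" by blast
    have "x \<noteq> 0" using x(3) g0 j by auto
    then have "x \<in> s ` {1..}" using x S by (auto simp: sin_zero_iff_int2 intro: exI[of _ "int j"])
    then obtain i where i: "1 \<le> i" "x = s i" by auto
    then have "real (n i) * pi = real j * pi" using n[of i] x by simp
    then have ni: "n i = j" by simp
    have "i \<le> k"
    proof (rule ccontr)
      assume "\<not> i \<le> k"
      then have "n k < n i" using nm[OF k, of i] by simp
      then show False using ni j by simp
    qed
    then show "j \<in> n ` {1..k}" using i ni by auto
  qed
  have "n ` {1..k} = {1..n k}" using sub sup by (rule subset_antisym)
  then have "n k = k" using card_image[OF inj] by simp
  then show ?thesis using n[OF k] s(1)[OF k] by simp
qed

lemma AE_stretch: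
  fixes P :: "real \<Rightarrow> bool"
  assumes "AE x in lebesgue. P x" "0 < e"
  shows "AE x in lebesgue. P (x / e)"
proof -
  obtain N where N: "N \<in> null_sets lebesgue" "{x. \<not> P x} \<subseteq> N"
    using assms(1) by (auto simp: eventually_ae_filter)
  have "negligible ((\<lambda>x. e * x) ` N)"
    by (rule negligible_differentiable_image_negligible)
      (use N(1) in \<open>auto simp: negligible_iff_null_sets intro!: derivative_intros\<close>)
  then have "(\<lambda>x. e * x) ` N \<in> null_sets lebesgue" by (simp add: negligible_iff_null_sets)
  moreover have "{x. \<not> P (x / e)} \<subseteq> (\<lambda>x. e * x) ` N"
    using N(2) assms(2) by (auto intro!: image_eqI[of _ _ "x / e" for x])
  ultimately show ?thesis by (auto simp: eventually_ae_filter)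
qed

lemma dirichlet_eigenvalue_minus:
  "dirichlet_eigenvalue p L A (\<lambda>x. - R x) lam \<longleftrightarrow> dirichlet_eigenvalue p L A R (- lam)"
  by (simp add: dirichlet_eigenvalue_def dirichlet_solution_def)

context conjugate_exponents
begin

section \<open>From the Dirichlet problem to the end value of the angle\<close>

lemma q_minus_1: "q - 1 = 1 / (p - 1)"
  using p1 pq by (simp add: field_simps)

text \<open>Where the coefficient is positive the flux relation can be inverted, since
  \<open>phi q\<close> is the inverse of \<open>phi p\<close>. The flux becomes the second unknown,
  and derivatives are altered on a negligible set only.\<close>

lemma dirichlet_solution_iff_sys:
  assumes A: "AE x in lebesgue. x \<in> {0<..<L} \<longrightarrow> 0 < A x"
  shows "dirichlet_solution p L A R lam u \<longleftrightarrow>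
    (\<exists>w. sys 0 L (\<lambda>x. A x powr (- 1 / (p - 1))) (\<lambda>x. lam * R x) u w) \<and> u 0 = 0 \<and> u L = 0"
proof -
  interpret qp: conjugate_exponents q p by (rule swap)
  let ?b = "\<lambda>x. A x powr (- 1 / (p - 1))"
  have flux: "w = A x * phi p v \<longleftrightarrow> v = ?b x * phi q w" if "0 < A x" for x v w
  proof -
    have b: "?b x = phi q (inverse (A x))"
    proof -
      have e: "- 1 / (p - 1) = - (q - 1)" by (simp add: q_minus_1)
      show ?thesis using that unfolding e powr_minus by (simp add: phi_pos inverse_powr)
    qed
    have "w = A x * phi p v \<longleftrightarrow> phi p v = inverse (A x) * w" using that by (auto simp: field_simps)
    also have "\<dots> \<longleftrightarrow> v = phi q (inverse (A x) * w)"
      using phi_phi qp.phi_phi by metis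
    finally show ?thesis unfolding phi_mult b .
  qed
  have acd: "abs_cont_deriv L f f' \<longleftrightarrow> ac_on 0 L f f'" for f f'
    by (simp add: abs_cont_deriv_def ac_on_def)
  obtain N0 where N0: "N0 \<in> null_sets lebesgue" "{x. \<not> (x \<in> {0<..<L} \<longrightarrow> 0 < A x)} \<subseteq> N0"
    using A by (auto simp: eventually_ae_filter)
  show ?thesis
  proof
    assume "dirichlet_solution p L A R lam u"
    then obtain u' w w' where u: "ac_on 0 L u u'" and w: "ac_on 0 L w w'" and bc: "u 0 = 0" "u L = 0"
      and ae: "AE x in lebesgue. x \<in> {0<..<L} \<longrightarrow> w x = A x * phi p (u' x) \<and> - w' x = lam * R x * phi p (u x)"
      by (auto simp: dirichlet_solution_def acd)
    obtain N where N: "N \<in> null_sets lebesgue"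
      "{x. \<not> (x \<in> {0<..<L} \<longrightarrow> w x = A x * phi p (u' x) \<and> - w' x = lam * R x * phi p (u x))} \<subseteq> N"
      using ae by (auto simp: eventually_ae_filter)
    \<comment> \<open>The endpoints join the exceptional set because the equation is posed on the
      open interval.\<close>
    have neg: "negligible (N \<union> N0 \<union> {0, L})"
      using N(1) N0(1) by (auto simp flip: negligible_iff_null_sets intro!: negligible_Un)
    have good: "w x = A x * phi p (u' x)" "- w' x = lam * R x * phi p (u x)" "0 < A x"
      if "x \<in> {0..L} - (N \<union> N0 \<union> {0, L})" for x
    proof -
      have x: "x \<in> {0<..<L}" "x \<notin> N" "x \<notin> N0" using that by auto
      show "w x = A x * phi p (u' x)" "- w' x = lam * R x * phi p (u x)" "0 < A x"
        using x N(2) N0(2) by blast+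
    qed
    have "ac_on 0 L u (\<lambda>x. ?b x * phi q (w x))"
    proof (rule ac_on_spike[OF u neg])
      show "?b x * phi q (w x) = u' x" if "x \<in> {0..L} - (N \<union> N0 \<union> {0, L})" for x
        using iffD1[OF flux[OF good(3)[OF that]] good(1)[OF that]] by (rule sym)
    qed simp
    moreover have "ac_on 0 L w (\<lambda>x. - (lam * R x * phi p (u x)))"
    proof (rule ac_on_spike[OF w neg])
      show "- (lam * R x * phi p (u x)) = w' x" if "x \<in> {0..L} - (N \<union> N0 \<union> {0, L})" for x
        using good(2)[OF that] by linarith
    qed simp
    ultimately show "(\<exists>w. sys 0 L ?b (\<lambda>x. lam * R x) u w) \<and> u 0 = 0 \<and> u L = 0"
      using bc by (auto simp: sys_def)
  next
    assume "(\<exists>w. sys 0 L ?b (\<lambda>x. lam * R x) u w) \<and> u 0 = 0 \<and> u L = 0"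
    then obtain w where u: "ac_on 0 L u (\<lambda>x. ?b x * phi q (w x))"
      and w: "ac_on 0 L w (\<lambda>x. - (lam * R x * phi p (u x)))" and bc: "u 0 = 0" "u L = 0"
      by (auto simp: sys_def)
    have "AE x in lebesgue. x \<in> {0<..<L} \<longrightarrow> w x = A x * phi p (?b x * phi q (w x)) \<and>
        - (- (lam * R x * phi p (u x))) = lam * R x * phi p (u x)"
      using A by eventually_elim (use flux in auto)
    then show "dirichlet_solution p L A R lam u"
      using u w bc unfolding dirichlet_solution_def acd by blast
  qed
qed

text \<open>Here the parameter stays on the weight, so its sign is arbitrary. This form serves to
  exclude nonpositive eigenvalues of the limit problem.\<close>

lemma eigenvalue_iff_angle:
  assumes L: "0 < L" and A: "AE x in lebesgue. 0 < A x"
    and b: "AI 0 L (\<lambda>x. A x powr (- 1 / (p - 1)))" and R: "AI 0 L R"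
  shows "dirichlet_eigenvalue p L A R lam \<longleftrightarrow> sin (end_angle L (\<lambda>x. A x powr (- 1 / (p - 1))) (\<lambda>x. lam * R x)) = 0"
proof -
  have A': "AE x in lebesgue. x \<in> {0<..<L} \<longrightarrow> 0 < A x" using A by eventually_elim simp
  have Bp: "AE x in lebesgue. x \<in> {0..L} \<longrightarrow> 0 < A x powr (- 1 / (p - 1))"
    using A by eventually_elim simp
  have R': "AI 0 L (\<lambda>x. lam * R x)" by (rule AI_cmult[OF R])
  obtain \<theta> where \<theta>: "angle_sol L (\<lambda>x. A x powr (- 1 / (p - 1))) (\<lambda>x. lam * R x) \<theta>"
    using angle_sol_exists[OF L b R'] by blast
  show ?thesis
    unfolding end_angle_eq[OF L b R' \<theta>] sys_nontrivial_iff[OF L b R' \<theta> Bp powr_ge_zero, symmetric]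
      dirichlet_eigenvalue_def dirichlet_solution_iff_sys[OF A'] by blast
qed

text \<open>Moving a positive eigenvalue parameter from the sign-changing weight to the positive
  coefficient makes the angle monotone in the parameter.\<close>

lemma sys_rescale:
  assumes "0 < lam"
  shows "(\<exists>w. sys a b B (\<lambda>x. lam * R x) u w) \<longleftrightarrow> (\<exists>w. sys a b (\<lambda>x. lam powr (q - 1) * B x) R u w)"
proof
  assume "\<exists>w. sys a b B (\<lambda>x. lam * R x) u w"
  then obtain w where u: "ac_on a b u (\<lambda>x. B x * phi q (w x))" and w: "ac_on a b w (\<lambda>x. - (lam * R x * phi p (u x)))"
    by (auto simp: sys_def)
  have "phi q (w x) = lam powr (q - 1) * phi q (w x / lam)" for x
    using phi_mult[of q lam "w x / lam"] assms by (simp add: phi_pos)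
  then have "ac_on a b u (\<lambda>x. lam powr (q - 1) * B x * phi q (inverse lam * w x))"
    by (intro ac_on_cong[OF u]) (simp_all add: divide_inverse mult_ac)
  moreover have "ac_on a b (\<lambda>x. inverse lam * w x) (\<lambda>x. - (R x * phi p (u x)))"
    by (rule ac_on_cong[OF ac_on_cmult[OF w, of "inverse lam"]]) (use assms in auto)
  ultimately show "\<exists>w. sys a b (\<lambda>x. lam powr (q - 1) * B x) R u w" by (auto simp: sys_def)
next
  assume "\<exists>w. sys a b (\<lambda>x. lam powr (q - 1) * B x) R u w"
  then obtain w where u: "ac_on a b u (\<lambda>x. lam powr (q - 1) * B x * phi q (w x))" and w: "ac_on a b w (\<lambda>x. - (R x * phi p (u x)))"
    by (auto simp: sys_def)
  have "ac_on a b u (\<lambda>x. B x * phi q (lam * w x))"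
    by (rule ac_on_cong[OF u]) (use assms in \<open>simp_all add: phi_mult phi_pos\<close>)
  moreover have "ac_on a b (\<lambda>x. lam * w x) (\<lambda>x. - (lam * R x * phi p (u x)))"
    by (rule ac_on_cong[OF ac_on_cmult[OF w, of lam]]) auto
  ultimately show "\<exists>w. sys a b B (\<lambda>x. lam * R x) u w" by (auto simp: sys_def)
qed

lemma pos_eigenvalue_iff_angle:
  assumes L: "0 < L" and A: "AE x in lebesgue. 0 < A x"
    and b: "AI 0 L (\<lambda>x. A x powr (- 1 / (p - 1)))" and R: "AI 0 L R" and lam: "0 < lam"
  shows "dirichlet_eigenvalue p L A R lam \<longleftrightarrow>
    sin (end_angle L (\<lambda>x. lam powr (q - 1) * A x powr (- 1 / (p - 1))) R) = 0"
proof -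
  have A': "AE x in lebesgue. x \<in> {0<..<L} \<longrightarrow> 0 < A x" using A by eventually_elim simp
  have Bp: "AE x in lebesgue. x \<in> {0..L} \<longrightarrow> 0 < lam powr (q - 1) * A x powr (- 1 / (p - 1))"
    using A by eventually_elim (use lam in simp)
  have b': "AI 0 L (\<lambda>x. lam powr (q - 1) * A x powr (- 1 / (p - 1)))" by (rule AI_cmult[OF b])
  obtain \<theta> where \<theta>: "angle_sol L (\<lambda>x. lam powr (q - 1) * A x powr (- 1 / (p - 1))) R \<theta>"
    using angle_sol_exists[OF L b' R] by blast
  have nn: "0 \<le> lam powr (q - 1) * A x powr (- 1 / (p - 1))" for x by simp
  show ?thesis
    unfolding end_angle_eq[OF L b' R \<theta>] sys_nontrivial_iff[OF L b' R \<theta> Bp nn, symmetric]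
      dirichlet_eigenvalue_def dirichlet_solution_iff_sys[OF A'] sys_rescale[OF lam] by blast
qed

text \<open>Since \<open>G\<close> vanishes at 0, the weight alone cannot move the angle away from
  0. This anchors the counting of levels at parameter 0.\<close>

lemma end_angle_zero:
  assumes "0 < L" "AI 0 L R"
  shows "end_angle L (\<lambda>x. 0) R = 0"
proof -
  have "G 0 = 0" using p1 by (simp add: G_def)
  then have "angle_sol L (\<lambda>x. 0) R (\<lambda>x. 0)"
    by (simp add: angle_sol_def angle_ode_def ac_on_const)
  then show ?thesis using end_angle_eq[OF assms(1) AI_const assms(2)] by simp
qed

text \<open>As \<open>F\<close> is nonnegative, a larger parameter never slows the angle. Since
  \<open>F\<close> vanishes at odd multiples of pi/2, strictness is gained near x = 0, where the
  angle starts at 0 and F(0) > 0; the integrating factor carries this gain to L.\<close>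

lemma end_angle_strict_mono:
  assumes L: "0 < L" and b: "AI 0 L b" and R: "AI 0 L R"
    and bp: "AE x in lebesgue. x \<in> {0..L} \<longrightarrow> 0 < b x" "\<And>x. 0 \<le> b x" and \<mu>: "\<mu>1 < \<mu>2"
  shows "end_angle L (\<lambda>x. \<mu>1 * b x) R < end_angle L (\<lambda>x. \<mu>2 * b x) R"
proof -
  have b1: "AI 0 L (\<lambda>x. \<mu>1 * b x)" and b2: "AI 0 L (\<lambda>x. \<mu>2 * b x)" by (rule AI_cmult[OF b])+
  obtain \<theta>1 where \<theta>1: "angle_sol L (\<lambda>x. \<mu>1 * b x) R \<theta>1" using angle_sol_exists[OF L b1 R] by blast
  obtain \<theta>2 where \<theta>2: "angle_sol L (\<lambda>x. \<mu>2 * b x) R \<theta>2" using angle_sol_exists[OF L b2 R] by blast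
  define h where "h x = (\<mu>2 * b x - \<mu>1 * b x) * F (\<theta>1 x) + (R x - R x) * G (\<theta>1 x)" for x
  obtain k where k: "AI 0 L k" "AI 0 L h" "ac_on 0 L (\<lambda>x. \<theta>2 x - \<theta>1 x) (\<lambda>x. k x * (\<theta>2 x - \<theta>1 x) + h x)"
    using angle_ode_diff[OF b1 b2 R R \<theta>1[THEN angle_sol_ode] \<theta>2[THEN angle_sol_ode]] unfolding h_def by blast
  have h: "h x = (\<mu>2 - \<mu>1) * b x * F (\<theta>1 x)" for x by (simp add: h_def algebra_simps)
  define E where "E x = exp (- integral {0..x} k)" for x
  have E: "continuous_on {0..L} E"
    unfolding E_def by (intro continuous_intros indefinite_integral_continuous_1 AI_integrable k)
  have hE: "AI 0 L (\<lambda>x. h x * E x)" by (rule AI_mult_continuous[OF k(2) E])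
  have hE0: "0 \<le> h x * E x" for x
    using bp(2) F_nonneg \<mu> by (simp add: h E_def)
  have F0: "F (\<theta>1 0) \<noteq> 0"
    using \<theta>1 p1 den_pos[of 0] by (simp add: angle_sol_def F_def)
  have cF: "continuous_on {0..L} (\<lambda>x. F (\<theta>1 x))"
    by (rule continuous_on_compose2[OF cont_F[of UNIV] ac_on_continuous[OF angle_sol_ac[OF \<theta>1]]]) simp
  have "0 \<in> {0..L}" using L by simp
  from continuous_on_nonzero_near[OF cF this F0] obtain d where d: "d > 0" "\<forall>t\<in>{0..L}. \<bar>t - 0\<bar> < d \<longrightarrow> F (\<theta>1 t) \<noteq> 0"
    by blast
  define e where "e = min (d / 2) L"
  have e: "0 < e" "e \<le> L" using d L by (auto simp: e_def)
  have Fp: "0 < F (\<theta>1 t)" if "t \<in> {0..e}" for t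
    using d(2)[rule_format, of t] that d(1) F_nonneg[of "\<theta>1 t"] by (auto simp: e_def less_le)
  have "0 < integral {0..e} (\<lambda>x. h x * E x)"
  proof (rule integral_pos_AE[OF AI_subinterval[OF hE] e(1)])
    show "AE x in lebesgue. x \<in> {0..e} \<longrightarrow> 0 < h x * E x"
      using bp(1) by eventually_elim (use Fp e \<mu> in \<open>auto simp: h E_def\<close>)
  qed (use e hE0 in auto)
  also have "\<dots> \<le> integral {0..L} (\<lambda>x. h x * E x)"
    by (rule integral_subset_le) (use e hE0 AI_integrable_sub[OF hE] in auto)
  finally have "0 < (\<theta>2 L - \<theta>1 L) * E L"
    using linear_ode[OF k(3,1,2), of L] \<theta>1 \<theta>2 L by (simp add: angle_sol_def E_def)
  then show ?thesis
    unfolding end_angle_eq[OF L b1 R \<theta>1] end_angle_eq[OF L b2 R \<theta>2]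
    by (simp add: zero_less_mult_iff E_def)
qed

lemma end_angle_continuous:
  assumes L: "0 < L" and b: "AI 0 L b" and R: "AI 0 L R"
  shows "continuous_on S (\<lambda>\<mu>. end_angle L (\<lambda>x. \<mu> * b x) R)"
proof -
  have "((\<lambda>\<mu>. end_angle L (\<lambda>x. \<mu> * b x) R) \<longlongrightarrow> end_angle L (\<lambda>x. \<mu>0 * b x) R) (at \<mu>0)" for \<mu>0
  proof -
    define I where "I = integral {0..L} (\<lambda>x. \<bar>b x\<bar>)"
    \<comment> \<open>The summand 1 makes the constant uniform over parameters within distance 1 of
      \<open>\<mu>0\<close>.\<close>
    define K where "K = C * ((\<bar>\<mu>0\<bar> + 1) * I + integral {0..L} (\<lambda>x. \<bar>R x\<bar>))"
    have I0: "0 \<le> I" unfolding I_def by (rule integral_nonneg[OF AI_integrable[OF AI_abs[OF b]]]) simp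
    have b0: "AI 0 L (\<lambda>x. \<mu>0 * b x)" by (rule AI_cmult[OF b])
    obtain \<theta> where \<theta>: "angle_sol L (\<lambda>x. \<mu>0 * b x) R \<theta>" using angle_sol_exists[OF L b0 R] by blast
    have bound: "norm (end_angle L (\<lambda>x. \<mu> * b x) R - end_angle L (\<lambda>x. \<mu>0 * b x) R)
        \<le> (\<bar>\<mu> - \<mu>0\<bar> * (C * I)) * (1 + exp (2 * K) * K)" if \<mu>: "\<bar>\<mu> - \<mu>0\<bar> < 1" for \<mu>
    proof -
      have b1: "AI 0 L (\<lambda>x. \<mu> * b x)" by (rule AI_cmult[OF b])
      obtain \<phi> where \<phi>: "angle_sol L (\<lambda>x. \<mu> * b x) R \<phi>" using angle_sol_exists[OF L b1 R] by blast
      have "\<bar>\<phi> L - \<theta> L\<bar> \<le> (\<bar>\<mu> - \<mu>0\<bar> * (C * I)) * (1 + exp (2 * K) * K)"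
      proof (rule angle_sol_perturbation[OF b0 b1 R R \<theta> \<phi>])
        have "integral {0..L} (\<lambda>x. \<bar>\<mu> * b x\<bar> + \<bar>R x\<bar>) = \<bar>\<mu>\<bar> * I + integral {0..L} (\<lambda>x. \<bar>R x\<bar>)"
          unfolding abs_mult I_def
          by (subst integral_add) (intro AI_integrable AI_cmult AI_abs b R | simp)+
        also have "\<dots> \<le> (\<bar>\<mu>0\<bar> + 1) * I + integral {0..L} (\<lambda>x. \<bar>R x\<bar>)"
          using \<mu> I0 by (intro add_mono mult_right_mono) auto
        finally show "C * integral {0..L} (\<lambda>x. \<bar>\<mu> * b x\<bar> + \<bar>R x\<bar>) \<le> K"
          unfolding K_def using C_nonneg by (rule mult_left_mono)
        fix x assume x: "x \<in> {0..L}"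
        have "AI 0 L (\<lambda>t. b t * F (\<theta> t))"
          by (intro AI_mult_continuous b continuous_on_compose2[OF cont_F[of UNIV] ac_on_continuous[OF angle_sol_ac[OF \<theta>]]]) simp
        then have bF: "AI 0 L (\<lambda>t. (\<mu> - \<mu>0) * (b t * F (\<theta> t)))" by (rule AI_cmult)
        have "integral {0..x} (\<lambda>t. (\<mu> * b t - \<mu>0 * b t) * F (\<theta> t) + (R t - R t) * G (\<theta> t))
          = integral {0..x} (\<lambda>t. (\<mu> - \<mu>0) * (b t * F (\<theta> t)))"
          by (rule integral_cong) (simp add: algebra_simps)
        also have "\<bar>\<dots>\<bar> \<le> integral {0..x} (\<lambda>t. \<bar>(\<mu> - \<mu>0) * (b t * F (\<theta> t))\<bar>)"
          by (rule integral_abs_le[OF bF]) (use x in auto)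
        also have "\<dots> \<le> integral {0..L} (\<lambda>t. \<bar>(\<mu> - \<mu>0) * (b t * F (\<theta> t))\<bar>)"
          by (rule integral_subset_le) (use x AI_integrable_sub[OF AI_abs[OF bF]] in auto)
        also have "\<dots> \<le> integral {0..L} (\<lambda>t. \<bar>\<mu> - \<mu>0\<bar> * (C * \<bar>b t\<bar>))"
        proof (rule integral_le)
          show "\<bar>(\<mu> - \<mu>0) * (b t * F (\<theta> t))\<bar> \<le> \<bar>\<mu> - \<mu>0\<bar> * (C * \<bar>b t\<bar>)" for t
            unfolding abs_mult using mult_right_mono[OF F_bound[of "\<theta> t"], of "\<bar>b t\<bar>"]
            by (intro mult_left_mono) (auto simp: mult.commute)
        qed (intro AI_integrable AI_abs AI_cmult bF b)+
        also have "\<dots> = \<bar>\<mu> - \<mu>0\<bar> * (C * I)" by (simp add: I_def)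
        finally show "\<bar>integral {0..x} (\<lambda>t. (\<mu> * b t - \<mu>0 * b t) * F (\<theta> t) + (R t - R t) * G (\<theta> t))\<bar>
          \<le> \<bar>\<mu> - \<mu>0\<bar> * (C * I)" .
      qed (use L in simp)
      then show ?thesis by (simp add: end_angle_eq[OF L b1 R \<phi>] end_angle_eq[OF L b0 R \<theta>])
    qed
    have "((\<lambda>\<mu>. end_angle L (\<lambda>x. \<mu> * b x) R - end_angle L (\<lambda>x. \<mu>0 * b x) R) \<longlongrightarrow> 0) (at \<mu>0)"
    proof (rule Lim_null_comparison)
      show "((\<lambda>\<mu>. (\<bar>\<mu> - \<mu>0\<bar> * (C * I)) * (1 + exp (2 * K) * K)) \<longlongrightarrow> 0) (at \<mu>0)"
        by (auto intro!: tendsto_eq_intros)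
      have "\<forall>\<^sub>F \<mu> in at \<mu>0. dist \<mu> \<mu>0 < 1" by (auto simp: eventually_at intro: exI[of _ 1])
      then show "\<forall>\<^sub>F \<mu> in at \<mu>0. norm (end_angle L (\<lambda>x. \<mu> * b x) R - end_angle L (\<lambda>x. \<mu>0 * b x) R)
          \<le> (\<bar>\<mu> - \<mu>0\<bar> * (C * I)) * (1 + exp (2 * K) * K)"
        by eventually_elim (use bound in \<open>auto simp: dist_real_def\<close>)
    qed
    then show ?thesis by (rule LIM_zero_cancel)
  qed
  then have "continuous_on UNIV (\<lambda>\<mu>. end_angle L (\<lambda>x. \<mu> * b x) R)"
    by (simp add: continuous_on_def)
  then show ?thesis by (rule continuous_on_subset) simp
qed

text \<open>The constant angle pi/2 is a barrier: there only the weight acts, and it pushes back.\<close>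

lemma end_angle_le_half_pi:
  assumes L: "0 < L" and B: "AI 0 L B" and R: "AI 0 L R" "\<And>x. R x \<le> 0"
  shows "end_angle L B R \<le> pi / 2"
proof -
  obtain \<theta> where \<theta>: "angle_sol L B R \<theta>" using angle_sol_exists[OF L B R(1)] by blast
  have "F (pi / 2) = 0" using q1 by (simp add: F_def)
  then have c: "angle_ode L B (\<lambda>x. 0) (\<lambda>x. pi / 2)" by (simp add: angle_ode_def ac_on_const)
  have "\<theta> L \<le> pi / 2"
    by (rule angle_ode_le[OF B B R(1) AI_const angle_sol_ode[OF \<theta>] c])
      (use L \<theta> R(2) G_nonneg in \<open>auto simp: angle_sol_def mult_nonpos_nonneg\<close>)
  then show ?thesis by (simp add: end_angle_eq[OF L B R(1) \<theta>])
qed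

end

text \<open>The limit and the blow-up are treated for the positive eigenvalues only; the negative ones
  are those of the opposite weight.\<close>

locale homogenization = conjugate_exponents +
  fixes L :: real and a r :: "real \<Rightarrow> real" and s :: "real \<Rightarrow> nat \<Rightarrow> real" and k :: nat
  assumes L: "0 < L" and muck: "muckenhoupt p a" and a_per: "periodic L a"
    and r_per: "periodic L r" and r_int: "AI 0 L r" and k: "1 \<le> k"
    and en: "\<forall>\<^sub>F \<epsilon> in at_right 0. enumerates_by (\<lambda>\<mu>. \<mu>) (s \<epsilon>)
           {\<mu>. 0 < \<mu> \<and> dirichlet_eigenvalue p L (\<lambda>x. a (x / \<epsilon>)) (\<lambda>x. r (x / \<epsilon>)) \<mu>}"
begin

definition b :: "real \<Rightarrow> real" where "b x = a x powr (- 1 / (p - 1))"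

text \<open>The end angle as a function of the eigenvalue parameter, after that parameter has moved
  to the positive coefficient. The convention \<open>0 powr (q - 1) = 0\<close> gives the right
  value at 0.\<close>

definition g :: "(real \<Rightarrow> real) \<Rightarrow> (real \<Rightarrow> real) \<Rightarrow> real \<Rightarrow> real" where
  "g B R \<mu> = end_angle L (\<lambda>x. \<mu> powr (q - 1) * B x) R"

lemma a_pos: "AE x in lebesgue. 0 < a x"
  using muck by (simp add: muckenhoupt_def)

lemma b_per: "periodic L b"
  using a_per by (simp add: periodic_def b_def)

lemma b_int: "AI 0 L b"
  using muck unfolding muckenhoupt_def b_def[abs_def] by blast

lemma b_mean_pos: "0 < average L b"
proof -
  have "0 < integral {0..L} b"
    by (rule integral_pos_AE[OF b_int L]) (use a_pos in \<open>auto simp: b_def\<close>)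
  then show ?thesis using L by (simp add: average_def)
qed

lemma g_strict_mono:
  assumes "AI 0 L B" "AI 0 L R" "AE x in lebesgue. x \<in> {0..L} \<longrightarrow> 0 < B x" "\<And>x. 0 \<le> B x"
  shows "strict_mono_on {0..} (g B R)"
  unfolding g_def
proof (rule strict_mono_onI)
  fix x y :: real assume "x \<in> {0..}" "y \<in> {0..}" "x < y"
  then have "x powr (q - 1) < y powr (q - 1)" using q1 by (intro powr_less_mono2) auto
  then show "end_angle L (\<lambda>t. x powr (q - 1) * B t) R < end_angle L (\<lambda>t. y powr (q - 1) * B t) R"
    by (rule end_angle_strict_mono[OF L assms])
qed

lemma g_continuous:
  assumes "AI 0 L B" "AI 0 L R"
  shows "continuous_on {0..} (g B R)"
proof -
  have "continuous_on {0..} (\<lambda>\<mu>::real. \<mu> powr (q - 1))"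
    by (rule continuous_on_powr') (use q1 in auto)
  then show ?thesis
    unfolding g_def by (rule continuous_on_compose2[OF end_angle_continuous[OF L assms, of UNIV]]) simp
qed

lemma g_0: "AI 0 L R \<Longrightarrow> g B R 0 = 0"
  using end_angle_zero[OF L] by (simp add: g_def)

text \<open>By strict monotonicity, comparing a parameter with the k-th positive eigenvalue amounts
  to comparing its end angle with k pi. The lemma serves both the oscillating and the limit
  problem.\<close>

lemma level:
  assumes A: "AE x in lebesgue. 0 < A x" and B: "AI 0 L (\<lambda>x. A x powr (- 1 / (p - 1)))" and R: "AI 0 L R"
    and e: "enumerates_by (\<lambda>\<mu>. \<mu>) t {\<mu>. 0 < \<mu> \<and> dirichlet_eigenvalue p L A R \<mu>}"
  shows "0 < t k" "\<And>\<mu>. 0 < \<mu> \<Longrightarrow> g (\<lambda>x. A x powr (- 1 / (p - 1))) R \<mu> < real k * pi \<longleftrightarrow> \<mu> < t k"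
    "\<And>\<mu>. 0 < \<mu> \<Longrightarrow> real k * pi < g (\<lambda>x. A x powr (- 1 / (p - 1))) R \<mu> \<longleftrightarrow> t k < \<mu>"
proof -
  let ?g = "g (\<lambda>x. A x powr (- 1 / (p - 1))) R"
  have "{\<mu>. 0 < \<mu> \<and> dirichlet_eigenvalue p L A R \<mu>} = {\<mu>. 0 < \<mu> \<and> sin (?g \<mu>) = 0}"
    unfolding g_def using pos_eigenvalue_iff_angle[OF L A B R] by blast
  then have e': "enumerates_by (\<lambda>\<mu>. \<mu>) t {\<mu>. 0 < \<mu> \<and> sin (?g \<mu>) = 0}" using e by simp
  have Bp: "AE x in lebesgue. x \<in> {0..L} \<longrightarrow> 0 < A x powr (- 1 / (p - 1))"
    using A by eventually_elim simp
  have m: "strict_mono_on {0..} ?g" by (rule g_strict_mono[OF B R Bp]) simp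
  have t: "0 < t k" "?g (t k) = real k * pi"
    using enumerates_level[OF g_continuous[OF B R] m g_0[OF R] e' k] by auto
  have lt: "?g x < ?g y \<longleftrightarrow> x < y" if "0 < x" "0 < y" for x y
    using that strict_mono_onD[OF m, of x y] strict_mono_onD[OF m, of y x]
    by (cases x y rule: linorder_cases) auto
  show "0 < t k" by fact
  show "?g \<mu> < real k * pi \<longleftrightarrow> \<mu> < t k" "real k * pi < ?g \<mu> \<longleftrightarrow> t k < \<mu>" if "0 < \<mu>" for \<mu>
    using lt[OF that t(1)] lt[OF t(1) that] t(2) by auto
qed

text \<open>A strict inequality for the averaged angle persists for small epsilon by
  \<open>averaging\<close>, and \<open>level\<close> turns it into a bound on the
  eigenvalue.\<close>

lemma eventually_level:
  assumes \<mu>: "0 < \<mu>"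
  shows "g (\<lambda>x. average L b) (\<lambda>x. average L r) \<mu> < real k * pi \<Longrightarrow> \<forall>\<^sub>F \<epsilon> in at_right 0. \<mu> < s \<epsilon> k"
    and "real k * pi < g (\<lambda>x. average L b) (\<lambda>x. average L r) \<mu> \<Longrightarrow> \<forall>\<^sub>F \<epsilon> in at_right 0. s \<epsilon> k < \<mu>"
proof -
  have lim: "((\<lambda>\<epsilon>. g (\<lambda>x. b (x / \<epsilon>)) (\<lambda>x. r (x / \<epsilon>)) \<mu>) \<longlongrightarrow> g (\<lambda>x. average L b) (\<lambda>x. average L r) \<mu>) (at_right 0)"
    unfolding g_def by (rule averaging[OF L b_per b_int r_per r_int])
  have pos: "\<forall>\<^sub>F \<epsilon> in at_right 0. \<epsilon> \<in> {0<..<1::real}" by (rule eventually_at_right_real) simp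
  have lev: "(g (\<lambda>x. b (x / \<epsilon>)) (\<lambda>x. r (x / \<epsilon>)) \<mu> < real k * pi \<longleftrightarrow> \<mu> < s \<epsilon> k) \<and>
     (real k * pi < g (\<lambda>x. b (x / \<epsilon>)) (\<lambda>x. r (x / \<epsilon>)) \<mu> \<longleftrightarrow> s \<epsilon> k < \<mu>)"
    if e: "enumerates_by (\<lambda>\<mu>. \<mu>) (s \<epsilon>)
           {\<mu>. 0 < \<mu> \<and> dirichlet_eigenvalue p L (\<lambda>x. a (x / \<epsilon>)) (\<lambda>x. r (x / \<epsilon>)) \<mu>}" and "\<epsilon> \<in> {0<..<1}" for \<epsilon>
  proof -
    have \<epsilon>: "0 < \<epsilon>" "\<epsilon> \<le> 1" using that by auto
    note l = level[OF AE_stretch[OF a_pos \<epsilon>(1)] oscillating_bounds(1)[OF L b_per b_int \<epsilon>, unfolded b_def]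
        oscillating_bounds(1)[OF L r_per r_int \<epsilon>] e]
    show ?thesis using l(2,3)[OF \<mu>] by (simp add: b_def)
  qed
  show "\<forall>\<^sub>F \<epsilon> in at_right 0. \<mu> < s \<epsilon> k" if "g (\<lambda>x. average L b) (\<lambda>x. average L r) \<mu> < real k * pi"
    using order_tendstoD(2)[OF lim that] en pos by eventually_elim (use lev in blast)
  show "\<forall>\<^sub>F \<epsilon> in at_right 0. s \<epsilon> k < \<mu>" if "real k * pi < g (\<lambda>x. average L b) (\<lambda>x. average L r) \<mu>"
    using order_tendstoD(1)[OF lim that] en pos by eventually_elim (use lev in blast)
qed

lemma blow_up:
  assumes "average L r \<le> 0"
  shows "filterlim (\<lambda>\<epsilon>. s \<epsilon> k) at_top (at_right 0)"
  unfolding filterlim_at_top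
proof
  fix Z :: real
  \<comment> \<open>Test parameters must be positive, whatever the sign of Z.\<close>
  define \<mu> where "\<mu> = max Z 1"
  have "g (\<lambda>x. average L b) (\<lambda>x. average L r) \<mu> \<le> pi / 2"
    unfolding g_def by (rule end_angle_le_half_pi[OF L AI_const AI_const assms])
  also have "\<dots> < 1 * pi" by simp
  also have "\<dots> \<le> real k * pi" using k by (intro mult_right_mono) auto
  finally have "\<forall>\<^sub>F \<epsilon> in at_right 0. \<mu> < s \<epsilon> k" by (intro eventually_level) (auto simp: \<mu>_def)
  then show "\<forall>\<^sub>F \<epsilon> in at_right 0. Z \<le> s \<epsilon> k" by eventually_elim (simp add: \<mu>_def)
qed

lemma homogenized_coeff_pos: "0 < homogenized_coeff p L a"
  using b_mean_pos by (simp add: homogenized_coeff_def b_def[abs_def])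

text \<open>What averages linearly is b = a^(-1/(p-1)), not a. The exponent 1 - p in the homogenized
  coefficient undoes that power, so the limit problem has exactly the averaged angle
  equation.\<close>

lemma homogenized_coeff_powr: "homogenized_coeff p L a powr (- 1 / (p - 1)) = average L b"
proof -
  have "(1 - p) * (- 1 / (p - 1)) = 1" using p1 by (simp add: field_simps)
  then have "(average L b powr (1 - p)) powr (- 1 / (p - 1)) = average L b"
    using b_mean_pos by (simp add: powr_powr)
  then show ?thesis by (simp add: homogenized_coeff_def b_def[abs_def])
qed

lemma converges:
  assumes e: "enumerates_by (\<lambda>\<mu>. \<mu>) t
      {\<mu>. 0 < \<mu> \<and> dirichlet_eigenvalue p L (\<lambda>x. homogenized_coeff p L a) (\<lambda>x. average L r) \<mu>}"
  shows "((\<lambda>\<epsilon>. s \<epsilon> k) \<longlongrightarrow> t k) (at_right 0)"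
proof -
  have A: "AE x in lebesgue. 0 < homogenized_coeff p L a" using homogenized_coeff_pos by simp
  note l = level[OF A AI_const AI_const e, unfolded homogenized_coeff_powr]
  show ?thesis
  proof (rule order_tendstoI)
    fix y assume "y < t k"
    \<comment> \<open>A positive test parameter below \<open>t k\<close> and at least y, also when y
      is negative.\<close>
    define \<mu> where "\<mu> = max y (t k / 2)"
    have \<mu>: "0 < \<mu>" "\<mu> < t k" using l(1) \<open>y < t k\<close> by (auto simp: \<mu>_def)
    have "\<forall>\<^sub>F \<epsilon> in at_right 0. \<mu> < s \<epsilon> k" by (intro eventually_level) (use \<mu> l(2) in auto)
    then show "\<forall>\<^sub>F \<epsilon> in at_right 0. y < s \<epsilon> k" by eventually_elim (simp add: \<mu>_def)
  next
    fix y assume "t k < y"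
    then show "\<forall>\<^sub>F \<epsilon> in at_right 0. s \<epsilon> k < y"
      using l(1,3) by (intro eventually_level) auto
  qed
qed

text \<open>For a nonpositive parameter the weight term pushes back, so the end angle is at most
  pi/2; it is positive by strict monotonicity from coefficient 0. The sine has no zero
  there.\<close>

lemma limit_eigenvalue_pos:
  assumes r: "0 < average L r"
    and ev: "dirichlet_eigenvalue p L (\<lambda>x. homogenized_coeff p L a) (\<lambda>x. average L r) \<mu>"
  shows "0 < \<mu>"
proof (rule ccontr)
  assume "\<not> 0 < \<mu>"
  then have R: "\<mu> * average L r \<le> 0" using r by (simp add: mult_nonpos_nonneg)
  have A: "AE x in lebesgue. 0 < homogenized_coeff p L a" using homogenized_coeff_pos by simp
  define e where "e = end_angle L (\<lambda>x. average L b) (\<lambda>x. \<mu> * average L r)"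
  have "sin e = 0"
    using ev eigenvalue_iff_angle[OF L A AI_const AI_const] unfolding homogenized_coeff_powr e_def by blast
  moreover have "e \<le> pi / 2"
    unfolding e_def by (rule end_angle_le_half_pi[OF L AI_const AI_const R])
  moreover have "0 < e"
    using end_angle_strict_mono[OF L AI_const[of 0 L "average L b"] AI_const, of 0 1 "\<mu> * average L r"]
      end_angle_zero[OF L AI_const] b_mean_pos by (simp add: e_def)
  ultimately show False using sin_gt_zero[of e] pi_gt_zero by linarith
qed

text \<open>All limit eigenvalues are positive, so listing them by absolute value is listing the
  positive ones in increasing order.\<close>

lemma converges_abs:
  assumes r: "0 < average L r"
    and e: "enumerates_by abs t {\<mu>. dirichlet_eigenvalue p L (\<lambda>x. homogenized_coeff p L a) (\<lambda>x. average L r) \<mu>}"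
  shows "((\<lambda>\<epsilon>. s \<epsilon> k) \<longlongrightarrow> t k) (at_right 0)"
proof (rule converges)
  let ?S = "{\<mu>. dirichlet_eigenvalue p L (\<lambda>x. homogenized_coeff p L a) (\<lambda>x. average L r) \<mu>}"
  have t: "t ` {1..} = ?S" and m: "strict_mono_on {1..} (\<lambda>k. \<bar>t k\<bar>)"
    using e by (auto simp: enumerates_by_def)
  have pos: "0 < t i" if "1 \<le> i" for i
    using limit_eigenvalue_pos[OF r, of "t i"] t that by auto
  have "strict_mono_on {1..} t"
  proof (rule strict_mono_onI)
    fix i j :: nat assume "i \<in> {1..}" "j \<in> {1..}" "i < j"
    then show "t i < t j" using strict_mono_onD[OF m, of i j] pos[of i] pos[of j] by simp
  qed
  moreover have "{\<mu>. 0 < \<mu> \<and> dirichlet_eigenvalue p L (\<lambda>x. homogenized_coeff p L a) (\<lambda>x. average L r) \<mu>} = ?S"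
    using limit_eigenvalue_pos[OF r] by blast
  ultimately show "enumerates_by (\<lambda>\<mu>. \<mu>) t
      {\<mu>. 0 < \<mu> \<and> dirichlet_eigenvalue p L (\<lambda>x. homogenized_coeff p L a) (\<lambda>x. average L r) \<mu>}"
    using t by (simp add: enumerates_by_def)
qed

end

section \<open>Reflection of the spectrum and conclusion\<close>

lemma enumerates_by_minus:
  assumes "enumerates_by key t S"
  shows "enumerates_by (\<lambda>\<mu>. key (- \<mu>)) (\<lambda>k. - t k) {\<mu>. - \<mu> \<in> S}"
proof -
  have "(\<lambda>k. - t k) ` {1..} = {\<mu>. - \<mu> \<in> t ` {1..}}"
    by (force simp: image_iff)
  then show ?thesis using assms by (simp add: enumerates_by_def)
qed

theorem theorem1p5:
  fixes p L :: real and a \<rho> :: "real \<Rightarrow> real"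
    and lam_pos lam_neg :: "real \<Rightarrow> nat \<Rightarrow> real" and lam0 :: "nat \<Rightarrow> real" and k :: nat
  assumes "1 < p" and "0 < L"
    and "muckenhoupt p a" and "periodic L a"
    and "periodic L \<rho>" and "indefinite_weight \<rho>" and "\<rho> absolutely_integrable_on {0<..<L}"
    and "\<forall>\<^sub>F \<epsilon> in at_right 0. enumerates_by (\<lambda>\<mu>. \<mu>) (lam_pos \<epsilon>)
           {\<mu>. 0 < \<mu> \<and> dirichlet_eigenvalue p L (\<lambda>x. a (x / \<epsilon>)) (\<lambda>x. \<rho> (x / \<epsilon>)) \<mu>}"
    and "\<forall>\<^sub>F \<epsilon> in at_right 0. enumerates_by (\<lambda>\<mu>. - \<mu>) (lam_neg \<epsilon>)
           {\<mu>. \<mu> < 0 \<and> dirichlet_eigenvalue p L (\<lambda>x. a (x / \<epsilon>)) (\<lambda>x. \<rho> (x / \<epsilon>)) \<mu>}"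
    and "average L \<rho> \<noteq> 0 \<Longrightarrow> enumerates_by abs lam0
           {\<mu>. dirichlet_eigenvalue p L (\<lambda>x. homogenized_coeff p L a) (\<lambda>x. average L \<rho>) \<mu>}"
    and "1 \<le> k"
  shows "(average L \<rho> = 0 \<longrightarrow>
            filterlim (\<lambda>\<epsilon>. lam_pos \<epsilon> k) at_top (at_right 0) \<and>
            filterlim (\<lambda>\<epsilon>. lam_neg \<epsilon> k) at_bot (at_right 0)) \<and>
         (average L \<rho> < 0 \<longrightarrow>
            ((\<lambda>\<epsilon>. lam_neg \<epsilon> k) \<longlongrightarrow> lam0 k) (at_right 0) \<and>
            filterlim (\<lambda>\<epsilon>. lam_pos \<epsilon> k) at_top (at_right 0)) \<and>
         (average L \<rho> > 0 \<longrightarrow>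
            ((\<lambda>\<epsilon>. lam_pos \<epsilon> k) \<longlongrightarrow> lam0 k) (at_right 0) \<and>
            filterlim (\<lambda>\<epsilon>. lam_neg \<epsilon> k) at_bot (at_right 0))"
proof -
  have \<rho>: "AI 0 L \<rho>" using assms(7) by (simp add: absolutely_integrable_on_Icc_iff_Ioo)
  have neg: "\<forall>\<^sub>F \<epsilon> in at_right 0. enumerates_by (\<lambda>\<mu>. \<mu>) (\<lambda>k. - lam_neg \<epsilon> k)
           {\<mu>. 0 < \<mu> \<and> dirichlet_eigenvalue p L (\<lambda>x. a (x / \<epsilon>)) (\<lambda>x. - \<rho> (x / \<epsilon>)) \<mu>}"
    using assms(9)
  proof eventually_elim
    case (elim \<epsilon>)
    from enumerates_by_minus[OF this] show ?case
      by (simp add: dirichlet_eigenvalue_minus)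
  qed
  have av: "average L (\<lambda>x. - \<rho> x) = - average L \<rho>"
    by (simp add: average_def)
  interpret P: homogenization p "p / (p - 1)" L a \<rho> lam_pos k
    by unfold_locales (use assms \<rho> in \<open>auto simp: field_simps\<close>)
  interpret N: homogenization p "p / (p - 1)" L a "\<lambda>x. - \<rho> x" "\<lambda>\<epsilon> k. - lam_neg \<epsilon> k" k
    by unfold_locales (use assms neg \<rho> in \<open>auto simp: periodic_def intro: AI_minus\<close>)
  have N_bot: "filterlim (\<lambda>\<epsilon>. lam_neg \<epsilon> k) at_bot (at_right 0)" if "0 \<le> average L \<rho>"
    using N.blow_up that by (simp add: av filterlim_uminus_at_bot)
  have N_lim: "((\<lambda>\<epsilon>. lam_neg \<epsilon> k) \<longlongrightarrow> lam0 k) (at_right 0)" if neg_av: "average L \<rho> < 0"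
  proof -
    have "((\<lambda>\<epsilon>. - lam_neg \<epsilon> k) \<longlongrightarrow> - lam0 k) (at_right 0)"
    proof (rule N.converges_abs)
      show "0 < average L (\<lambda>x. - \<rho> x)" using neg_av by (simp add: av)
      show "enumerates_by abs (\<lambda>k. - lam0 k)
         {\<mu>. dirichlet_eigenvalue p L (\<lambda>x. homogenized_coeff p L a) (\<lambda>x. average L (\<lambda>x. - \<rho> x)) \<mu>}"
        using enumerates_by_minus[OF assms(10)] neg_av by (simp add: av dirichlet_eigenvalue_minus)
    qed
    then show ?thesis by (simp add: tendsto_minus_cancel_left)
  qed
  show ?thesis
    using P.blow_up P.converges_abs[OF _ assms(10)] N_bot N_lim by auto
qed

end
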